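(* Let $k \ge 2$. There exist a density $\alpha > 0$ and an on-line strategy for the $t=3$ choice $k$-SAT Achlioptas process such that, with $m = \lfloor \alpha n \rfloor$, the uniformly random formula $F_k(n,m)$ is unsatisfiable with probability tending to $1$ as $n \to \infty$, while the formula produced by the strategy is satisfiable with probability tending to $1$ as $n \to \infty$.
   Context: Fix $n$ Boolean variables $x_1,\dots,x_n$. A $k$-clause is a disjunction of $k$ literals on $k$ distinct variables; there are $2^k\binom{n}{k}$ of them. The random formula $F_k(n,m)$ is the conjunction of $m$ clauses, each chosen independently and uniformly from these $2^k\binom{n}{k}$ clauses. In the $t$-choice Achlioptas process for $k$-SAT, for each step $i = 1,\dots,m$ one is presented with $t$ independent, uniformly random $k$-clauses; a strategy selects one of them (its choice may depend on all clauses presented and selected at earlier steps and on the current $t$ clauses, but not on future ones) and adds it to the formula, discarding the others. After $m$ steps the result is a $k$-SAT formula with $m$ clauses on the variables $x_1,\dots,x_n$. *)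

theory Defs
  imports "HOL-Probability.Probability"
begin

text \<open>
  The literal \<open>(v, True)\<close> is the variable \<open>v\<close> and \<open>(v, False)\<close> its negation.
  Clauses are unordered; formulas are lists, so repeated clauses are counted.
\<close>

type_synonym literal = "nat \<times> bool"
type_synonym clause = "literal set"
type_synonym formula = "clause list"

definition satisfies :: "(nat \<Rightarrow> bool) \<Rightarrow> formula \<Rightarrow> bool" where
  "satisfies \<sigma> F \<longleftrightarrow> (\<forall>C\<in>set F. \<exists>(v, b)\<in>C. \<sigma> v = b)"

definition satisfiable :: "formula \<Rightarrow> bool" where
  "satisfiable F \<longleftrightarrow> (\<exists>\<sigma>. satisfies \<sigma> F)"

definition k_clauses :: "nat \<Rightarrow> nat \<Rightarrow> clause set" where
  "k_clauses k n = {C. C \<subseteq> {1..n} \<times> UNIV \<and> card C = k \<and> inj_on fst C}"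

lemma finite_k_clauses: "finite (k_clauses k n)"
  by (rule finite_subset[of _ "Pow ({1..n} \<times> UNIV)"]) (auto simp: k_clauses_def)

lemma card_k_clauses: "card (k_clauses k n) = 2 ^ k * (n choose k)"
proof -
  define S where "S = (SIGMA A:{A. A \<subseteq> {1..n} \<and> card A = k}. Pow A)"
  define f :: "nat set \<times> nat set \<Rightarrow> clause" where "f = (\<lambda>(A, B). (\<lambda>v. (v, v \<in> B)) ` A)"
  have inj: "inj_on f S"
  proof (rule inj_onI, clarify)
    fix A B A' B'
    assume S: "(A, B) \<in> S" "(A', B') \<in> S" and eq: "f (A, B) = f (A', B')"
    have "fst ` f (A, B) = A" "fst ` f (A', B') = A'"
      by (simp_all add: f_def image_image)
    with eq have A: "A = A'" by simp
    have "B = {v. (v, True) \<in> f (A, B)}" "B' = {v. (v, True) \<in> f (A', B')}"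
      using S by (auto simp: f_def S_def)
    with eq A show "A = A' \<and> B = B'" by simp
  qed
  have "f ` S = k_clauses k n"
  proof (intro equalityI subsetI)
    fix C assume "C \<in> f ` S"
    then show "C \<in> k_clauses k n"
      by (auto simp: f_def S_def k_clauses_def card_image inj_on_def)
  next
    fix C assume C: "C \<in> k_clauses k n"
    let ?A = "fst ` C" and ?B = "{v. (v, True) \<in> C}"
    have inj_C: "inj_on fst C" using C by (simp add: k_clauses_def)
    have "(v, b) \<in> C \<Longrightarrow> b = ((v, True) \<in> C)" for v b
      using inj_onD[OF inj_C, of "(v, b)" "(v, True)"] by (cases b) auto
    then have "C = f (?A, ?B)"
      by (force simp: f_def image_iff)
    moreover have "(?A, ?B) \<in> S"
      using C by (force simp: S_def k_clauses_def card_image)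
    ultimately show "C \<in> f ` S" by (rule image_eqI)
  qed
  then have "card (k_clauses k n) = card S"
    using card_image[OF inj] by simp
  also have "\<dots> = (\<Sum>A\<in>{A. A \<subseteq> {1..n} \<and> card A = k}. card (Pow A))"
    unfolding S_def
    by (rule card_SigmaI) (auto dest: finite_subset)
  also have "\<dots> = (\<Sum>A\<in>{A. A \<subseteq> {1..n} \<and> card A = k}. 2 ^ k)"
    by (rule sum.cong) (auto simp: card_Pow dest: finite_subset)
  also have "\<dots> = 2 ^ k * (n choose k)"
    by (simp add: n_subsets)
  finally show ?thesis .
qed

text \<open>
  For \<open>n < k\<close> there are no clauses and the distributions below are unspecified.
\<close>

definition random_clause :: "nat \<Rightarrow> nat \<Rightarrow> clause pmf" where
  "random_clause k n = pmf_of_set (k_clauses k n)"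

definition random_formula :: "nat \<Rightarrow> nat \<Rightarrow> nat \<Rightarrow> formula pmf" where
  "random_formula k n m = replicate_pmf m (random_clause k n)"

text \<open>
  A history records, earliest step first, the clauses presented at each step and the
  clause selected among them. A strategy maps the history of the earlier steps and the
  clauses currently presented to the selected clause.
\<close>

type_synonym history = "(clause list \<times> clause) list"
type_synonym strategy = "history \<Rightarrow> clause list \<Rightarrow> clause"

definition online_strategy :: "nat \<Rightarrow> strategy \<Rightarrow> bool" where
  "online_strategy t S \<longleftrightarrow> (\<forall>h cs. length cs = t \<longrightarrow> S h cs \<in> set cs)"

primrec achlioptas_process :: "nat \<Rightarrow> nat \<Rightarrow> nat \<Rightarrow> strategy \<Rightarrow> nat \<Rightarrow> history pmf" where
  "achlioptas_process t k n S 0 = return_pmf []"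
| "achlioptas_process t k n S (Suc i) =
     bind_pmf (achlioptas_process t k n S i) (\<lambda>h.
     bind_pmf (replicate_pmf t (random_clause k n)) (\<lambda>cs.
     return_pmf (h @ [(cs, S h cs)])))"

definition achlioptas_formula :: "nat \<Rightarrow> nat \<Rightarrow> nat \<Rightarrow> strategy \<Rightarrow> nat \<Rightarrow> formula pmf" where
  "achlioptas_formula t k n S m = map_pmf (map snd) (achlioptas_process t k n S m)"

end

theory Submission
  imports Defs
begin

text \<open>
  Unsatisfiability of the random formula is a first moment argument that counts only the
  assignments whose set of true variables is maximal: every false variable must then be blocked
  by a clause in which it is the only satisfied literal. This gives unsatisfiability at every density
  \<open>\<alpha>\<close> with \<open>(1 - 2\<^sup>-\<^sup>k)\<^sup>\<alpha> (2 - exp (- k \<alpha> / (2\<^sup>k - 1))) < 1\<close>.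

  The strategy looks at the three current clauses only, so the selected clauses are independent. For
  \<open>k \<ge> 3\<close> it prefers two or more positive literals to one, and one to none. Keeping the two most positive
  literals of each selected clause leaves a biased random 2-SAT formula. Such a formula is satisfiable
  with high probability as soon as its implication digraph is a subcritical branching process, that is,
  as soon as some positive weight on the literals is contracted by the matrix of expected implications.
  For \<open>k = 2\<close> the preference for positive literals alone survives only up to density about 1.68, below
  the first moment bound of about 1.87; letting the strength of the preference depend on the variable modulo 3
  raises this to about 1.92. The densities used are \<open>19/10\<close>, \<open>19/4\<close> and \<open>7/10 \<cdot> 2\<^sup>k\<close> for \<open>k = 2\<close>, \<open>k = 3\<close>, \<open>k \<ge> 4\<close>.
\<close>

section \<open>Bicycles in unsatisfiable 2-SAT formulas\<close>

text \<open>Counting all assignments would prove unsatisfiability only above about 2.41 for k = 2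
  and 5.19 for k = 3, beyond the densities these selection rules survive (about 1.92 and 4.86); this
  is why the count is restricted. For k >= 4 the density 7/10 * 2^k exceeds even the plain bound, as
  7/10 > ln 2.

  The three choices enter through one two-step cycle. For large k almost all kept pairs are purely
  positive, so a negative literal implies about 2 \<alpha> positive ones, while a positive literal
  implies about 2 \<alpha> / 8^k negative ones, 8^-k being the probability that all three presented
  clauses are purely negative. With \<alpha> of order 2^k the product is of order 2^-k. Two choices
  would put 4^k in place of 8^k and make the product at \<alpha> = 7/10 * 2^k close to 1.96, which
  is supercritical.\<close>

definition neg :: "literal \<Rightarrow> literal" where
  "neg l = (fst l, \<not> snd l)"

lemma neg_neg [simp]: "neg (neg l) = l"
  and fst_neg [simp]: "fst (neg l) = fst l"
  and neg_neq [simp]: "neg l \<noteq> l" "l \<noteq> neg l"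
  by (auto simp: neg_def prod_eq_iff)

lemma eq_fst_literal: "fst a = fst b \<Longrightarrow> a = b \<or> a = neg b"
  by (auto simp: neg_def prod_eq_iff)

definition literals :: "nat \<Rightarrow> literal set" where
  "literals n = {1..n} \<times> UNIV"

lemma finite_literals [simp]: "finite (literals n)"
  and card_literals: "card (literals n) = 2 * n"
  and neg_in_literals [simp]: "neg l \<in> literals n \<longleftrightarrow> l \<in> literals n"
  by (auto simp: literals_def neg_def card_cartesian_product mem_Times_iff)

lemma pair_in_k_clauses:
  "{a, b} \<in> k_clauses 2 n \<longleftrightarrow> a \<in> literals n \<and> b \<in> literals n \<and> fst a \<noteq> fst b"
  by (cases "a = b") (auto simp: k_clauses_def literals_def card_insert_if)

lemma k_clauses_2E:
  assumes "C \<in> k_clauses 2 n"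
  obtains a b where "C = {a, b}" "a \<in> literals n" "b \<in> literals n" "fst a \<noteq> fst b"
proof -
  have "card C = 2" using assms by (simp add: k_clauses_def)
  then obtain a b where "C = {a, b}" by (auto simp: card_2_iff)
  with assms that pair_in_k_clauses show ?thesis by metis
qed

text \<open>The clauses of an implication path: the arc from \<open>a\<close> to \<open>b\<close> is
  the clause \<open>{neg a, b}\<close>. A path through r literals has r - 1 clauses.\<close>

fun chain :: "literal list \<Rightarrow> clause list" where
  "chain (a # b # zs) = {neg a, b} # chain (b # zs)"
| "chain zs = []"

text \<open>This separates the two closing clauses of a bicycle from its chain: a chain clause
  negates a listed literal other than the last one, and its second literal is listed.\<close>

lemma in_chainD:
  assumes "C \<in> set (chain zs)" "distinct (map fst zs)"
  shows "\<exists>a\<in>set zs. a \<noteq> last zs \<and> neg a \<in> C \<and> (\<exists>b\<in>set zs. C = {neg a, b})"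
  using assms
proof (induction zs rule: chain.induct)
  case (1 a b zs)
  show ?case
  proof (cases "C = {neg a, b}")
    case True
    then show ?thesis using "1.prems" by (intro bexI[of _ a]) auto
  next
    case False
    then have "\<exists>a'\<in>set (b # zs). a' \<noteq> last (b # zs) \<and> neg a' \<in> C \<and>
        (\<exists>b'\<in>set (b # zs). C = {neg a', b'})"
      using 1 by simp
    then show ?thesis by (metis last_ConsR list.distinct(1) list.set_intros(2))
  qed
qed auto

lemma fst_in_chain:
  "C \<in> set (chain zs) \<Longrightarrow> l \<in> C \<Longrightarrow> fst l \<in> fst ` set zs"
  by (induction zs rule: chain.induct) auto

text \<open>The variable of the head occurs in the first clause only. Distinctness turns the product
  over the set of chain clauses into a product along the list.\<close>

lemma distinct_chain:
  assumes "distinct (map fst zs)"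
  shows "distinct (chain zs)"
  using assms
proof (induction zs rule: chain.induct)
  case (1 a b zs)
  have "{neg a, b} \<notin> set (chain (b # zs))"
    using fst_in_chain[of "{neg a, b}" "b # zs" "neg a"] "1.prems" by auto
  with 1 show ?case by simp
qed auto

section \<open>The implication digraph and the 2-SAT criterion\<close>

definition implies :: "formula \<Rightarrow> (literal \<times> literal) set" where
  "implies F = {(a, b). {neg a, b} \<in> set F}"

lemma implies_contra: "(a, b) \<in> implies F \<Longrightarrow> (neg b, neg a) \<in> implies F"
  by (simp add: implies_def insert_commute)

lemma implies_star_contra: "(a, b) \<in> (implies F)\<^sup>* \<Longrightarrow> (neg b, neg a) \<in> (implies F)\<^sup>*"
  by (induction rule: rtrancl_induct) (auto intro: implies_contra converse_rtrancl_into_rtrancl)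

text \<open>A largest consistent set of literals closed under implication decides every variable:
  for an undecided one, some literal \<open>b\<close> on it does not imply \<open>neg b\<close>, and
  everything \<open>b\<close> implies can be added.\<close>

lemma satisfiable_2cnf:
  assumes F: "set F \<subseteq> k_clauses 2 n"
    and no_cycle: "\<And>x. x \<in> literals n \<Longrightarrow>
      \<not> ((x, neg x) \<in> (implies F)\<^sup>* \<and> (neg x, x) \<in> (implies F)\<^sup>*)"
  shows "satisfiable F"
proof -
  define E where "E = implies F"
  define ok where "ok S \<longleftrightarrow> S \<subseteq> literals n \<and> E `` S \<subseteq> S \<and> (\<forall>a\<in>S. neg a \<notin> S)" for S
  have E_lit: "a \<in> literals n \<and> b \<in> literals n" if "(a, b) \<in> E" for a b
    using that F pair_in_k_clauses[of "neg a" b n] by (auto simp: E_def implies_def)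
  have Estar_lit: "b \<in> literals n" if "(a, b) \<in> E\<^sup>*" "a \<in> literals n" for a b
    using that by (induction rule: rtrancl_induct) (auto dest: E_lit)
  have "ok {}" by (simp add: ok_def)
  moreover have "\<forall>S. ok S \<longrightarrow> card S < Suc (2 * n)"
    using card_mono[OF finite_literals[of n]] by (auto simp: ok_def card_literals less_Suc_eq_le)
  ultimately obtain S where S: "ok S" and max: "\<And>S'. ok S' \<Longrightarrow> card S' \<le> card S"
    using ex_has_greatest_nat[of ok "{}" card "Suc (2 * n)"] by auto
  have finS: "finite S" using S finite_subset[OF _ finite_literals] by (auto simp: ok_def)
  have closed: "b \<in> S" if "a \<in> S" "(a, b) \<in> E\<^sup>*" for a b
    using that(2,1) by (induction rule: rtrancl_induct) (use S in \<open>auto simp: ok_def\<close>)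
  have total: "a \<in> S \<or> neg a \<in> S" if a: "a \<in> literals n" for a
  proof (rule ccontr)
    assume "\<not> (a \<in> S \<or> neg a \<in> S)"
    then obtain b where b: "b \<in> literals n" "b \<notin> S" "neg b \<notin> S" "(b, neg b) \<notin> E\<^sup>*"
      using no_cycle[OF a] a by (metis E_def neg_in_literals neg_neg)
    define S' where "S' = S \<union> E\<^sup>* `` {b}"
    have contra: "(neg y, neg x) \<in> E\<^sup>*" if "(x, y) \<in> E\<^sup>*" for x y
      using implies_star_contra that by (simp add: E_def)
    have "neg x \<notin> S'" if x: "x \<in> S'" for x
    proof
      assume nx: "neg x \<in> S'"
      have 1: "neg x \<notin> S \<or> x \<notin> S" using S by (auto simp: ok_def)
      \<comment> \<open>By contraposition \<open>y\<close> implies \<open>neg b\<close>, so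
        \<open>y\<close> in \<open>S\<close> would put \<open>neg b\<close> into the closed set
        \<open>S\<close>.\<close>
      have 2: "y \<notin> S" if "(b, neg y) \<in> E\<^sup>*" for y
        using contra[OF that] closed[of y "neg b"] b by auto
      show False
      proof (cases "(b, x) \<in> E\<^sup>* \<and> (b, neg x) \<in> E\<^sup>*")
        case True
        \<comment> \<open>The path goes from \<open>b\<close> to \<open>x\<close>, then from
          \<open>x\<close> to \<open>neg b\<close>, the latter being the contrapositive of the path
          from \<open>b\<close> to \<open>neg x\<close>.\<close>
        then have "(b, neg b) \<in> E\<^sup>*" using contra[of b "neg x"] by (metis neg_neg rtrancl_trans)
        with b show False by simp
      next
        case False
        then show False using x nx 1 2[of x] 2[of "neg x"] by (auto simp: S'_def)
      qed
    qed
    moreover have "E `` S' \<subseteq> S'"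
      using S by (auto simp: S'_def ok_def intro: rtrancl_into_rtrancl)
    moreover have "S' \<subseteq> literals n"
      using S b Estar_lit by (auto simp: S'_def ok_def)
    ultimately have "ok S'" by (auto simp: ok_def)
    moreover have "S \<subset> S'" using b by (auto simp: S'_def)
    moreover have "finite S'"
      using \<open>S' \<subseteq> literals n\<close> finite_subset[OF _ finite_literals] by auto
    ultimately show False using max[of S'] psubset_card_mono[of S' S] by simp
  qed
  define \<sigma> where "\<sigma> v \<longleftrightarrow> (v, True) \<in> S" for v
  have sat: "\<sigma> (fst a) = snd a" if "a \<in> S" for a
    using that S by (cases a; cases "snd a") (auto simp: \<sigma>_def ok_def neg_def)
  have "satisfies \<sigma> F"
    unfolding satisfies_def
  proof
    fix C assume C: "C \<in> set F"
    then obtain a b where ab: "C = {a, b}" "a \<in> literals n" using F by (meson k_clauses_2E subsetD)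
    have "(neg a, b) \<in> E" using C ab by (simp add: E_def implies_def)
    then have "a \<in> S \<or> b \<in> S"
      using total[OF ab(2)] closed[of "neg a" b] by blast
    with sat ab show "\<exists>(v, b)\<in>C. \<sigma> v = b" by force
  qed
  then show ?thesis by (auto simp: satisfiable_def)
qed

lemma chain_append:
  "zs \<noteq> [] \<Longrightarrow> chain (zs @ [z]) = chain zs @ [{neg (last zs), z}]"
  by (induction zs rule: chain.induct) auto

text \<open>
  Take a literal \<open>q\<close> on a contradictory cycle with the shortest path to \<open>neg q\<close>; by minimality the
  variables on that path after \<open>q\<close> are distinct. Extend it towards \<open>q\<close> until a variable repeats. The clause
  of the first step \<open>q \<rightarrow> hd zs\<close> is \<open>{hd zs, zs ! t}\<close> with \<open>zs ! t = neg q\<close>. A chain on \<open>r\<close> variables with two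
  extra clauses has \<open>r + 1\<close> clauses, so its expected number carries a factor \<open>1 / n\<close>.
\<close>

lemma bicycle_exists:
  assumes F: "set F \<subseteq> k_clauses 2 n" and unsat: "\<not> satisfiable F"
  shows "\<exists>zs t v. set zs \<subseteq> literals n \<and> distinct (map fst zs) \<and> 2 \<le> length zs \<and> t < length zs \<and>
    fst v \<in> fst ` set zs \<and> v \<in> literals n \<and>
    insert {hd zs, zs ! t} (insert {neg (last zs), v} (set (chain zs))) \<subseteq> set F"
proof -
  define E where "E = implies F"
  have E_lit: "a \<in> literals n \<and> b \<in> literals n \<and> fst a \<noteq> fst b" if "(a, b) \<in> E" for a b
    using that F pair_in_k_clauses[of "neg a" b n] by (auto simp: E_def implies_def)
  define bad where "bad x \<longleftrightarrow> (x, neg x) \<in> E\<^sup>* \<and> (neg x, x) \<in> E\<^sup>*" for x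
  define P where "P d \<longleftrightarrow> (\<exists>x. bad x \<and> (x, neg x) \<in> E ^^ d)" for d
  obtain x0 where "bad x0"
    using satisfiable_2cnf[OF F] unsat by (auto simp: bad_def E_def)
  then have "\<exists>d. P d"
    unfolding P_def bad_def by (meson rtrancl_imp_relpow)
  then obtain d where Pd: "P d" and dmin: "\<And>e. e < d \<Longrightarrow> \<not> P e"
    using exists_least_iff[of P] by blast
  then obtain q where q: "bad q" "(q, neg q) \<in> E ^^ d" by (auto simp: P_def)
  then obtain f where f: "f 0 = q" "f d = neg q" "\<And>i. i < d \<Longrightarrow> (f i, f (Suc i)) \<in> E"
    by (auto simp: relpow_fun_conv)
  have f_path: "(f i, f (i + e)) \<in> E ^^ e" if "i + e \<le> d" for i e
    unfolding relpow_fun_conv using that f(3) by (intro exI[of _ "\<lambda>j. f (i + j)"]) auto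
  have f_star: "(f i, f j) \<in> E\<^sup>*" if "i \<le> j" "j \<le> d" for i j
    using f_path[of i "j - i"] that by (auto intro: relpow_imp_rtrancl)
  have cyc: "(f i, f j) \<in> E\<^sup>*" if "i \<le> d" "j \<le> d" for i j
  proof -
    have "(f i, neg q) \<in> E\<^sup>*" "(neg q, q) \<in> E\<^sup>*" "(q, f j) \<in> E\<^sup>*"
      using f_star[of i d] f_star[of 0 j] that f(1,2) q(1) by (auto simp: bad_def)
    then show ?thesis by (meson rtrancl_trans)
  qed
  \<comment> \<open>Every \<open>f i\<close> lies on the contradictory cycle, so a proper subpath
    from a literal to its negation would contradict the minimality of \<open>d\<close>. The bound on
    \<open>j - i\<close> excludes only the two endpoints.\<close>
  have no_neg: "f j \<noteq> neg (f i)" if "i \<le> j" "j \<le> d" "j - i < d" for i j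
  proof
    assume eq: "f j = neg (f i)"
    have "(f i, neg (f i)) \<in> E ^^ (j - i)" using f_path[of i "j - i"] that eq by auto
    moreover have "bad (f i)" using cyc[of i j] cyc[of j i] that eq by (simp add: bad_def)
    ultimately show False using dmin[OF that(3)] unfolding P_def by blast
  qed
  \<comment> \<open>A repeated literal would allow the stretch between its occurrences to be cut
    out.\<close>
  have no_eq: "f i \<noteq> f j" if "i < j" "j \<le> d" for i j
  proof
    assume eq: "f i = f j"
    have "(q, f i) \<in> E ^^ i" using f_path[of 0 i] that f(1) by auto
    moreover have "(f j, neg q) \<in> E ^^ (d - j)" using f_path[of j "d - j"] that f(2) by auto
    ultimately have "(q, neg q) \<in> E ^^ (i + (d - j))"
      using eq by (auto simp: relpow_add)
    moreover have "i + (d - j) < d" using that by linarith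
    ultimately show False using dmin[of "i + (d - j)"] q(1) unfolding P_def by blast
  qed
  have d2: "2 \<le> d"
  proof (rule ccontr)
    assume "\<not> 2 \<le> d"
    then consider "d = 0" | "d = 1" by linarith
    then show False
    proof cases
      case 1 then show False using f by simp
    next
      case 2 then show False using f(1,2) f(3)[of 0] E_lit[of q "neg q"] by simp
    qed
  qed
  \<comment> \<open>The start \<open>f 0 = q\<close> is left out because \<open>f d = neg q\<close>
    is on the same variable.\<close>
  define us where "us = map f [1..<Suc d]"
  have len_us: "length us = d" by (simp add: us_def)
  have dist_us: "distinct (map fst us)"
    unfolding us_def map_map distinct_map
  proof (intro conjI)
    show "inj_on (fst \<circ> f) (set [1..<Suc d])"
    proof (rule linorder_inj_onI)
      fix i j assume "i < j" "i \<in> set [1..<Suc d]" "j \<in> set [1..<Suc d]"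
      then show "(fst \<circ> f) i \<noteq> (fst \<circ> f) j"
        using no_eq[of i j] no_neg[of i j] eq_fst_literal[of "f j" "f i"] by auto
    qed auto
  qed auto
  have lit_us: "set us \<subseteq> literals n"
  proof -
    have "f i \<in> literals n" if "1 \<le> i" "i \<le> d" for i
      using f(3)[of "i - 1"] that E_lit by fastforce
    then show ?thesis by (auto simp: us_def)
  qed
  have chain_map: "set (chain (map g [a..<b])) \<subseteq> set F"
    if "\<And>i. a \<le> i \<Longrightarrow> Suc i < b \<Longrightarrow> (g i, g (Suc i)) \<in> E" for g a b
    using that
  proof (induction b)
    case (Suc b)
    show ?case
    proof (cases "a < b")
      case True
      then have "set (chain (map g [a..<b])) \<subseteq> set F" using Suc by auto
      moreover have "(g (b - 1), g b) \<in> E" using Suc.prems[of "b - 1"] True by auto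
      ultimately show ?thesis using True
        by (auto simp: chain_append last_map E_def implies_def)
    qed (auto simp: upt_Suc)
  qed simp
  have chain_us: "set (chain us) \<subseteq> set F"
    unfolding us_def by (rule chain_map) (use f(3) in auto)
  \<comment> \<open>A longest extension on fresh variables from which \<open>q\<close> is still
    reachable; reachability guarantees a next arc, and maximality forces that arc to return to a
    variable already visited.\<close>
  define Q where "Q ys \<longleftrightarrow> distinct (map fst (us @ ys)) \<and> set (us @ ys) \<subseteq> literals n \<and>
    set (chain (us @ ys)) \<subseteq> set F \<and> (last (us @ ys), q) \<in> E\<^sup>*" for ys
  have last_us: "last us = neg q" using d2 f(2) by (simp add: us_def last_map)
  have "Q []"
    using dist_us lit_us chain_us last_us q(1) by (auto simp: Q_def bad_def)
  moreover have "\<forall>ys. Q ys \<longrightarrow> length ys < Suc (2 * n)"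
  proof (intro allI impI)
    fix ys assume "Q ys"
    then have "distinct (us @ ys)" "set (us @ ys) \<subseteq> literals n"
      by (auto simp: Q_def distinct_map)
    then have "length (us @ ys) \<le> 2 * n"
      using distinct_card[of "us @ ys"] card_mono[OF finite_literals[of n], of "set (us @ ys)"]
      by (simp only: card_literals)
    then show "length ys < Suc (2 * n)" by simp
  qed
  ultimately obtain ys where ys: "Q ys" and max: "\<And>ys'. Q ys' \<Longrightarrow> length ys' \<le> length ys"
    using ex_has_greatest_nat[of Q "[]" length "Suc (2 * n)"] by auto
  define zs where "zs = us @ ys"
  have us_ne: "us \<noteq> []" using len_us d2 by auto
  \<comment> \<open>The variable of \<open>q\<close> is already used by \<open>neg q\<close> at the
    end of \<open>us\<close>, so the path to \<open>q\<close> has at least one arc left.\<close>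
  have "last zs \<noteq> q"
  proof (cases ys rule: rev_cases)
    case Nil then show ?thesis using last_us by (simp add: zs_def)
  next
    case (snoc ys' y)
    have "last us \<in> set us" using us_ne by simp
    then have "fst q \<in> fst ` set us" using last_us by (metis fst_neg image_eqI)
    then show ?thesis using ys snoc by (auto simp: zs_def Q_def)
  qed
  moreover have "(last zs, q) \<in> E\<^sup>*" using ys by (simp add: zs_def Q_def)
  ultimately obtain v where v: "(last zs, v) \<in> E" "(v, q) \<in> E\<^sup>*"
    by (meson converse_rtranclE)
  have "fst v \<in> fst ` set zs"
  proof (rule ccontr)
    assume "fst v \<notin> fst ` set zs"
    then have "Q (ys @ [v])"
      using ys v E_lit[OF v(1)] us_ne chain_append[of "us @ ys" v]
      by (auto simp: Q_def zs_def E_def implies_def)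
    then show False using max[of "ys @ [v]"] by simp
  qed
  moreover have "{hd zs, zs ! (d - 1)} \<in> set F"
  proof -
    have "hd zs = f 1" using d2 us_ne by (simp add: zs_def us_def hd_append hd_map del: upt_Suc)
    moreover have "zs ! (d - 1) = neg q"
      using d2 f(2) by (simp add: zs_def us_def nth_append)
    ultimately show ?thesis using f(3)[of 0] f(1) d2
      by (simp add: E_def implies_def insert_commute)
  qed
  moreover have "{neg (last zs), v} \<in> set F" "v \<in> literals n"
    using v(1) E_lit[OF v(1)] by (auto simp: E_def implies_def)
  moreover have "2 \<le> length zs" "d - 1 < length zs" using d2 len_us by (auto simp: zs_def)
  moreover have "set zs \<subseteq> literals n" "distinct (map fst zs)" "set (chain zs) \<subseteq> set F"
    using ys unfolding Q_def zs_def[symmetric] by blast+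
  ultimately show ?thesis
    by (intro exI[of _ zs] exI[of _ "d - 1"] exI[of _ v] conjI insert_subsetI)
qed

section \<open>Subcritical random 2-SAT\<close>

lemma prob_replicate_pmf_Suc:
  "measure_pmf.prob (replicate_pmf (Suc m) p) S =
    (\<integral>x. measure_pmf.prob (replicate_pmf m p) {xs. x # xs \<in> S} \<partial>measure_pmf p)"
proof -
  have eq: "replicate_pmf (Suc m) p = bind_pmf p (\<lambda>x. map_pmf ((#) x) (replicate_pmf m p))"
    by (simp add: map_pmf_def)
  have "emeasure (measure_pmf (replicate_pmf (Suc m) p)) S =
    (\<integral>\<^sup>+x. ennreal (measure_pmf.prob (replicate_pmf m p) {xs. x # xs \<in> S}) \<partial>measure_pmf p)"
    unfolding eq emeasure_bind_pmf emeasure_map_pmf vimage_def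
    by (simp add: measure_pmf.emeasure_eq_measure)
  also have "\<dots> = ennreal (\<integral>x. measure_pmf.prob (replicate_pmf m p) {xs. x # xs \<in> S} \<partial>measure_pmf p)"
    by (intro nn_integral_eq_integral measure_pmf.integrable_const_bound[where B = 1]) auto
  finally show ?thesis
    by (simp add: measure_pmf.emeasure_eq_measure)
qed

lemma integral_pmf_mono_bounded:
  fixes f g :: "'a \<Rightarrow> real"
  assumes "\<And>x. x \<in> set_pmf p \<Longrightarrow> f x \<le> g x" "\<And>x. \<bar>f x\<bar> \<le> B" "\<And>x. \<bar>g x\<bar> \<le> B'"
  shows "(\<integral>x. f x \<partial>measure_pmf p) \<le> (\<integral>x. g x \<partial>measure_pmf p)"
  using assms
  by (intro integral_mono_AE measure_pmf.integrable_const_bound[where B = B]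
      measure_pmf.integrable_const_bound[where B = B']) (auto simp: AE_measure_pmf_iff)

text \<open>The first two terms of the binomial expansion. At \<open>f = 0\<close> the truncated
  exponent is harmless because its coefficient vanishes. Two inductions on the number of draws close
  with it.\<close>

lemma add_power_ge:
  fixes y d :: real
  assumes "0 \<le> y" "0 \<le> d"
  shows "y ^ f + real f * d * y ^ (f - 1) \<le> (y + d) ^ f"
proof (induction f)
  case (Suc f)
  have "y ^ Suc f + real (Suc f) * d * y ^ f = y * (y ^ f) + d * y ^ f + real f * d * y ^ f"
    by (simp add: algebra_simps)
  also have "real f * d * y ^ f = y * (real f * d * y ^ (f - 1))"
    by (cases f) auto
  also have "y * (y ^ f) + d * y ^ f + y * (real f * d * y ^ (f - 1)) =
      y * (y ^ f + real f * d * y ^ (f - 1)) + d * y ^ f"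
    by (simp add: algebra_simps)
  also have "\<dots> \<le> y * (y + d) ^ f + d * (y + d) ^ f"
    using assms Suc by (intro add_mono mult_left_mono power_mono) auto
  finally show ?case by (simp add: algebra_simps)
qed simp

text \<open>Distinct elements need distinct positions, which leaves at most
  \<open>m ^ card A\<close> placements. In the induction either the later draws already cover
  \<open>A\<close>, or the first draw is some \<open>a\<close> and the rest covers
  \<open>A - {a}\<close>; \<open>add_power_ge\<close> with increment 1 turns m into m + 1.\<close>

lemma prob_replicate_superset:
  assumes "finite A"
  shows "measure_pmf.prob (replicate_pmf m p) {xs. A \<subseteq> set xs} \<le> (\<Prod>a\<in>A. real m * pmf p a)"
  using assms
proof (induction m arbitrary: A)
  case 0
  then show ?case by (cases "A = {}") (auto simp: prod_nonneg)
next
  case (Suc m)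
  let ?P = "\<lambda>A. measure_pmf.prob (replicate_pmf m p) {xs. A \<subseteq> set xs}"
  have P01: "0 \<le> ?P A" "?P A \<le> 1" for A by auto
  have "measure_pmf.prob (replicate_pmf (Suc m) p) {xs. A \<subseteq> set xs} =
      (\<integral>x. ?P (A - {x}) \<partial>measure_pmf p)"
    unfolding prob_replicate_pmf_Suc
    by (intro Bochner_Integration.integral_cong refl arg_cong2[of _ _ _ _ measure]) auto
  also have "\<dots> \<le> (\<integral>x. ?P A + (\<Sum>a\<in>A. indicator {a} x * ?P (A - {a})) \<partial>measure_pmf p)"
  proof (rule integral_pmf_mono_bounded[where B = 1 and B' = "1 + real (card A)"])
    fix x
    have "(\<Sum>a\<in>A. indicator {a} x * ?P (A - {a})) = (if x \<in> A then ?P (A - {x}) else 0)"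
      using Suc.prems by (simp add: indicator_def if_distrib[of "\<lambda>u. u * _"] sum.delta')
    then show "?P (A - {x}) \<le> ?P A + (\<Sum>a\<in>A. indicator {a} x * ?P (A - {a}))"
      by simp
    have "(\<Sum>a\<in>A. indicator {a} x * ?P (A - {a})) \<le> (\<Sum>a\<in>A. 1)"
      by (intro sum_mono) (auto simp: indicator_def)
    then have "(\<Sum>a\<in>A. indicator {a} x * ?P (A - {a})) \<le> real (card A)" by simp
    moreover have "0 \<le> (\<Sum>a\<in>A. indicator {a} x * ?P (A - {a}))"
      by (intro sum_nonneg) auto
    ultimately show "\<bar>?P A + (\<Sum>a\<in>A. indicator {a} x * ?P (A - {a}))\<bar> \<le> 1 + real (card A)"
      using P01[of A] by linarith
  qed (use P01 in auto)
  also have "\<dots> = ?P A + (\<Sum>a\<in>A. pmf p a * ?P (A - {a}))"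
    by (subst Bochner_Integration.integral_add)
      (auto simp: measure_pmf_single measure_pmf.emeasure_eq_measure intro!: integrable_sum
        measure_pmf.integrable_const_bound[where B = 1])
  also have "\<dots> \<le> (\<Prod>a\<in>A. real m * pmf p a) +
      (\<Sum>a\<in>A. pmf p a * (\<Prod>b\<in>A - {a}. real m * pmf p b))"
    using Suc by (intro add_mono sum_mono mult_left_mono) auto
  also have "(\<Sum>a\<in>A. pmf p a * (\<Prod>b\<in>A - {a}. real m * pmf p b)) =
      (\<Sum>a\<in>A. real m ^ (card A - 1) * (\<Prod>b\<in>A. pmf p b))"
  proof (rule sum.cong)
    fix a assume "a \<in> A"
    then show "pmf p a * (\<Prod>b\<in>A - {a}. real m * pmf p b) =
        real m ^ (card A - 1) * (\<Prod>b\<in>A. pmf p b)"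
      using Suc.prems by (simp add: prod.distrib prod.remove[of A a] )
  qed simp
  also have "(\<Prod>a\<in>A. real m * pmf p a) + \<dots> =
      (real m ^ card A + real (card A) * 1 * real m ^ (card A - 1)) * (\<Prod>b\<in>A. pmf p b)"
    by (simp add: prod.distrib algebra_simps)
  also have "\<dots> \<le> (real m + 1) ^ card A * (\<Prod>b\<in>A. pmf p b)"
    by (intro mult_right_mono add_power_ge prod_nonneg) auto
  finally show ?case by (simp add: prod.distrib add.commute)
qed

section \<open>Weighted counting of chains and bicycles\<close>

lemma sum_lists_Suc:
  assumes "finite L"
  shows "(\<Sum>zs\<in>{zs. set zs \<subseteq> L \<and> length zs = Suc r}. f zs) =
    (\<Sum>a\<in>L. \<Sum>zs\<in>{zs. set zs \<subseteq> L \<and> length zs = r}. f (a # zs))"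
proof -
  have "(\<Sum>a\<in>L. \<Sum>zs\<in>{zs. set zs \<subseteq> L \<and> length zs = r}. f (a # zs)) =
      (\<Sum>(a, zs)\<in>L \<times> {zs. set zs \<subseteq> L \<and> length zs = r}. f (a # zs))"
    by (rule sum.cartesian_product)
  also have "\<dots> = (\<Sum>zs\<in>{zs. set zs \<subseteq> L \<and> length zs = Suc r}. f zs)"
    by (rule sum.reindex_bij_witness[of _ "\<lambda>zs. (hd zs, tl zs)" "\<lambda>(a, zs). a # zs"])
      (auto simp: length_Suc_conv)
  finally show ?thesis by simp
qed

text \<open>Power iteration: for the nonnegative matrix M with entries
  \<open>\<mu> {neg a, b}\<close> the hypothesis \<open>row\<close> reads M w \<le> \<rho> w, and
  since w dominates the constant 1, the r-th power of M applied to 1 is at most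
  \<open>\<rho> ^ r * w\<close>.\<close>

lemma sum_chain_weight:
  fixes \<mu> :: "clause \<Rightarrow> real" and w :: "literal \<Rightarrow> real"
  assumes "finite L" and pos: "\<And>C. 0 \<le> \<mu> C" and "0 \<le> \<rho>"
    and w: "\<And>a. a \<in> L \<Longrightarrow> 1 \<le> w a"
    and row: "\<And>a. a \<in> L \<Longrightarrow> (\<Sum>b\<in>L. \<mu> {neg a, b} * w b) \<le> \<rho> * w a"
    and "a \<in> L"
  shows "(\<Sum>zs\<in>{zs. set zs \<subseteq> L \<and> length zs = r}. prod_list (map \<mu> (chain (a # zs)))) \<le> \<rho> ^ r * w a"
  using \<open>a \<in> L\<close>
proof (induction r arbitrary: a)
  case 0
  have "{zs. set zs \<subseteq> L \<and> length zs = 0} = {[]}" by auto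
  then show ?case using w[OF 0] by simp
next
  case (Suc r)
  have "(\<Sum>zs\<in>{zs. set zs \<subseteq> L \<and> length zs = Suc r}. prod_list (map \<mu> (chain (a # zs)))) =
      (\<Sum>b\<in>L. \<mu> {neg a, b} * (\<Sum>zs\<in>{zs. set zs \<subseteq> L \<and> length zs = r}. prod_list (map \<mu> (chain (b # zs)))))"
    by (simp add: sum_lists_Suc[OF \<open>finite L\<close>] sum_distrib_left)
  also have "\<dots> \<le> (\<Sum>b\<in>L. \<mu> {neg a, b} * (\<rho> ^ r * w b))"
    by (intro sum_mono mult_left_mono Suc.IH pos)
  also have "\<dots> = \<rho> ^ r * (\<Sum>b\<in>L. \<mu> {neg a, b} * w b)"
    by (simp add: sum_distrib_left mult_ac)
  also have "\<dots> \<le> \<rho> ^ r * (\<rho> * w a)"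
    using row[OF Suc.prems] \<open>0 \<le> \<rho>\<close> by (intro mult_left_mono) auto
  finally show ?case by (simp add: mult_ac)
qed

text \<open>The two closing clauses differ from each other and from all chain clauses, so each
  contributes its own factor, bounded by \<kappa>. With distinct variables, no listed literal has
  its negation in the list.\<close>

lemma prob_bicycle:
  assumes zs: "distinct (map fst zs)" "zs \<noteq> []" "t < length zs"
    and le: "\<And>C. real m * pmf p C \<le> \<kappa>"
  shows "measure_pmf.prob (replicate_pmf m p)
      {F. insert {hd zs, zs ! t} (insert {neg (last zs), v} (set (chain zs))) \<subseteq> set F}
    \<le> \<kappa>\<^sup>2 * prod_list (map (\<lambda>C. real m * pmf p C) (chain zs))"
proof -
  let ?\<mu> = "\<lambda>C. real m * pmf p C"
  have neg_notin: "neg a \<notin> set zs" if "a \<in> set zs" for a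
  proof
    assume "neg a \<in> set zs"
    with that zs(1) have "neg a = a" by (metis distinct_map fst_neg inj_onD)
    then show False by simp
  qed
  have mem: "hd zs \<in> set zs" "last zs \<in> set zs" "zs ! t \<in> set zs" using zs by auto
  \<comment> \<open>This clause consists of listed literals, while every chain clause contains the
    negation of one.\<close>
  have "{hd zs, zs ! t} \<notin> set (chain zs)"
  proof
    assume "{hd zs, zs ! t} \<in> set (chain zs)"
    from in_chainD[OF this zs(1)] obtain a where "a \<in> set zs" "neg a \<in> {hd zs, zs ! t}" by auto
    then show False using neg_notin[of a] mem by auto
  qed
  moreover have "{neg (last zs), v} \<notin> set (chain zs)"
  proof
    assume "{neg (last zs), v} \<in> set (chain zs)"
    from in_chainD[OF this zs(1)] obtain a b where
      ab: "a \<in> set zs" "a \<noteq> last zs" "b \<in> set zs" "{neg (last zs), v} = {neg a, b}"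
      by auto
    have "neg (last zs) \<in> {neg a, b}" using ab(4) by blast
    then show False using ab(1-3) neg_notin mem by (metis insertE neg_neg singletonD)
  qed
  moreover have "{hd zs, zs ! t} \<noteq> {neg (last zs), v}"
    using neg_notin[of "last zs"] mem by (metis insert_iff singletonD)
  ultimately have "(\<Prod>C\<in>insert {hd zs, zs ! t} (insert {neg (last zs), v} (set (chain zs))). ?\<mu> C) =
      ?\<mu> {hd zs, zs ! t} * ?\<mu> {neg (last zs), v} * prod_list (map ?\<mu> (chain zs))"
    using distinct_chain[OF zs(1)] by (simp add: prod.distinct_set_conv_list)
  also have "\<dots> \<le> \<kappa> * \<kappa> * prod_list (map ?\<mu> (chain zs))"
  proof (intro mult_right_mono mult_mono le)
    show "0 \<le> \<kappa>" using le[of undefined] by (smt (verit) pmf_nonneg mult_nonneg_nonneg of_nat_0_le_iff)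
  qed (auto intro!: prod_list_nonneg)
  finally show ?thesis
    using prob_replicate_superset[of "insert {hd zs, zs ! t} (insert {neg (last zs), v} (set (chain zs)))" m p]
    by (simp add: power2_eq_square)
qed

text \<open>A union bound over bicycles. On r variables there are r positions \<open>t\<close> and
  at most 2 r literals \<open>v\<close>; the 2 n possible heads contribute chain weight at most
  \<open>R * \<rho> ^ (r - 1)\<close> each. For \<kappa> of order 1 / n the total is of order 1 /
  n.\<close>

lemma prob_unsat_le:
  fixes w :: "literal \<Rightarrow> real"
  assumes D: "set_pmf D \<subseteq> k_clauses 2 n"
    and le: "\<And>C. real m * pmf D C \<le> \<kappa>"
    and w: "\<And>a. a \<in> literals n \<Longrightarrow> 1 \<le> w a" "\<And>a. a \<in> literals n \<Longrightarrow> w a \<le> R"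
    and row: "\<And>a. a \<in> literals n \<Longrightarrow>
      real m * (\<Sum>b\<in>literals n. pmf D {neg a, b} * w b) \<le> \<rho> * w a"
    and "0 \<le> \<rho>" "0 \<le> R"
  shows "measure_pmf.prob (replicate_pmf m D) {F. \<not> satisfiable F} \<le>
    4 * R * real n * \<kappa>\<^sup>2 * (\<Sum>r\<le>n. (real r)\<^sup>2 * \<rho> ^ (r - 1))"
proof -
  define Z where "Z r = {zs. set zs \<subseteq> literals n \<and> distinct (map fst zs) \<and> length zs = r}" for r
  define V where "V zs = {v \<in> literals n. fst v \<in> fst ` set zs}" for zs :: "literal list"
  define B where "B zs t v = {F. insert {hd zs, zs ! t} (insert {neg (last zs), v} (set (chain zs))) \<subseteq> set F}"
    for zs :: "literal list" and t v
  let ?P = "measure_pmf.prob (replicate_pmf m D)"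
  let ?\<mu> = "\<lambda>C. real m * pmf D C"
  have finZ: "finite (Z r)" for r
    by (rule finite_subset[OF _ finite_lists_length_eq[OF finite_literals[of n], of r]]) (auto simp: Z_def)
  have finV: "finite (V zs)" for zs by (simp add: V_def)
  have cardV: "card (V zs) \<le> 2 * length zs" for zs
  proof -
    have "V zs \<subseteq> (fst ` set zs) \<times> UNIV" by (force simp: V_def)
    then have "card (V zs) \<le> card ((fst ` set zs) \<times> (UNIV :: bool set))"
      by (intro card_mono) auto
    also have "\<dots> \<le> 2 * length zs"
      using card_image_le[of "set zs" fst] card_length[of zs] by (simp add: card_cartesian_product)
    finally show ?thesis .
  qed
  have sub: "F \<in> (\<Union>r\<in>{2..n}. \<Union>zs\<in>Z r. \<Union>t<r. \<Union>v\<in>V zs. B zs t v)"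
    if F: "F \<in> set_pmf (replicate_pmf m D)" "\<not> satisfiable F" for F
  proof -
    have "set F \<subseteq> k_clauses 2 n" using F(1) D by (auto simp: set_replicate_pmf)
    from bicycle_exists[OF this F(2)]
    have "\<exists>zs t v. set zs \<subseteq> literals n \<and> distinct (map fst zs) \<and> 2 \<le> length zs \<and>
        t < length zs \<and> fst v \<in> fst ` set zs \<and> v \<in> literals n \<and> F \<in> B zs t v"
      unfolding B_def mem_Collect_eq .
    then obtain zs t v where
      *: "set zs \<subseteq> literals n" "distinct (map fst zs)" "2 \<le> length zs" "t < length zs"
      "fst v \<in> fst ` set zs" "v \<in> literals n" "F \<in> B zs t v"
      by (elim exE conjE)
    have "length zs = card (fst ` set zs)" using distinct_card[OF *(2)] by simp
    also have "\<dots> \<le> card {1..n}" using *(1) by (intro card_mono) (auto simp: literals_def)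
    finally have "length zs \<le> n" by simp
    with * show ?thesis
      by (intro UN_I[of "length zs"] UN_I[of zs] UN_I[of t] UN_I[of v]) (auto simp: Z_def V_def)
  qed
  have "?P {F. \<not> satisfiable F} = ?P ({F. \<not> satisfiable F} \<inter> set_pmf (replicate_pmf m D))"
    by (simp add: measure_Int_set_pmf)
  also have "\<dots> \<le> ?P (\<Union>r\<in>{2..n}. \<Union>zs\<in>Z r. \<Union>t<r. \<Union>v\<in>V zs. B zs t v)"
    using sub by (intro measure_pmf.finite_measure_mono) auto
  also have "\<dots> \<le> (\<Sum>r\<in>{2..n}. ?P (\<Union>zs\<in>Z r. \<Union>t<r. \<Union>v\<in>V zs. B zs t v))"
    by (intro measure_pmf.finite_measure_subadditive_finite) auto
  also have "\<dots> \<le> (\<Sum>r\<in>{2..n}. 4 * R * real n * \<kappa>\<^sup>2 * ((real r)\<^sup>2 * \<rho> ^ (r - 1)))"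
  proof (rule sum_mono)
    fix r assume r: "r \<in> {2..n}"
    have "?P (\<Union>zs\<in>Z r. \<Union>t<r. \<Union>v\<in>V zs. B zs t v) \<le> (\<Sum>zs\<in>Z r. ?P (\<Union>t<r. \<Union>v\<in>V zs. B zs t v))"
      using finZ by (intro measure_pmf.finite_measure_subadditive_finite) auto
    also have "\<dots> \<le> (\<Sum>zs\<in>Z r. 2 * (real r)\<^sup>2 * \<kappa>\<^sup>2 * prod_list (map ?\<mu> (chain zs)))"
    proof (rule sum_mono)
      fix zs assume zs: "zs \<in> Z r"
      have "?P (\<Union>t<r. \<Union>v\<in>V zs. B zs t v) \<le> (\<Sum>t<r. ?P (\<Union>v\<in>V zs. B zs t v))"
        by (intro measure_pmf.finite_measure_subadditive_finite) auto
      also have "\<dots> \<le> (\<Sum>t<r. \<Sum>v\<in>V zs. ?P (B zs t v))"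
        using finV by (intro sum_mono measure_pmf.finite_measure_subadditive_finite) auto
      also have "\<dots> \<le> (\<Sum>t<r. \<Sum>v\<in>V zs. \<kappa>\<^sup>2 * prod_list (map ?\<mu> (chain zs)))"
        unfolding B_def using zs r by (intro sum_mono prob_bicycle le) (auto simp: Z_def)
      also have "\<dots> = real r * real (card (V zs)) * (\<kappa>\<^sup>2 * prod_list (map ?\<mu> (chain zs)))"
        by simp
      also have "\<dots> \<le> real r * (2 * real r) * (\<kappa>\<^sup>2 * prod_list (map ?\<mu> (chain zs)))"
      proof (intro mult_right_mono mult_left_mono)
        have "real (card (V zs)) \<le> real (2 * r)"
          using cardV[of zs] zs by (intro of_nat_mono) (auto simp: Z_def)
        then show "real (card (V zs)) \<le> 2 * real r" by simp
      qed (auto intro!: mult_nonneg_nonneg prod_list_nonneg)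
      finally show "?P (\<Union>t<r. \<Union>v\<in>V zs. B zs t v) \<le> 2 * (real r)\<^sup>2 * \<kappa>\<^sup>2 * prod_list (map ?\<mu> (chain zs))"
        by (simp add: power2_eq_square mult_ac)
    qed
    \<comment> \<open>Forgetting that the variables are distinct only adds nonnegative terms, and it
      lets the sum factor along the chain.\<close>
    also have "\<dots> \<le> (\<Sum>zs\<in>{zs. set zs \<subseteq> literals n \<and> length zs = Suc (r - 1)}.
        2 * (real r)\<^sup>2 * \<kappa>\<^sup>2 * prod_list (map ?\<mu> (chain zs)))"
      using r by (intro sum_mono2 finite_lists_length_eq)
        (auto simp: Z_def intro!: mult_nonneg_nonneg prod_list_nonneg)
    also have "\<dots> = 2 * (real r)\<^sup>2 * \<kappa>\<^sup>2 * (\<Sum>a\<in>literals n.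
        \<Sum>zs\<in>{zs. set zs \<subseteq> literals n \<and> length zs = r - 1}. prod_list (map ?\<mu> (chain (a # zs))))"
      by (simp only: sum_lists_Suc[OF finite_literals] sum_distrib_left)
    also have "\<dots> \<le> 2 * (real r)\<^sup>2 * \<kappa>\<^sup>2 * (\<Sum>a\<in>literals n. \<rho> ^ (r - 1) * w a)"
      using w row \<open>0 \<le> \<rho>\<close>
      by (intro mult_left_mono sum_mono sum_chain_weight) (auto simp: sum_distrib_left mult_ac)
    also have "\<dots> \<le> 2 * (real r)\<^sup>2 * \<kappa>\<^sup>2 * (\<Sum>a\<in>literals n. \<rho> ^ (r - 1) * R)"
      using w \<open>0 \<le> \<rho>\<close> by (intro mult_left_mono sum_mono) auto
    also have "\<dots> = 4 * R * real n * \<kappa>\<^sup>2 * ((real r)\<^sup>2 * \<rho> ^ (r - 1))"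
      by (simp add: card_literals)
    finally show "?P (\<Union>zs\<in>Z r. \<Union>t<r. \<Union>v\<in>V zs. B zs t v) \<le>
      4 * R * real n * \<kappa>\<^sup>2 * ((real r)\<^sup>2 * \<rho> ^ (r - 1))" .
  qed
  also have "\<dots> \<le> (\<Sum>r\<le>n. 4 * R * real n * \<kappa>\<^sup>2 * ((real r)\<^sup>2 * \<rho> ^ (r - 1)))"
    using \<open>0 \<le> R\<close> \<open>0 \<le> \<rho>\<close> by (intro sum_mono2) auto
  finally show ?thesis by (simp add: sum_distrib_left)
qed

text \<open>With \<rho> = \<mu>^2, one factor r \<mu>^r stays bounded while the other remains
  summable.\<close>

lemma summable_square_geometric:
  fixes \<rho> :: real
  assumes "0 \<le> \<rho>" "\<rho> < 1"
  shows "summable (\<lambda>r. (real r)\<^sup>2 * \<rho> ^ (r - 1))"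
proof -
  define \<mu> where "\<mu> = sqrt \<rho>"
  have \<mu>: "0 \<le> \<mu>" "\<mu> < 1" "\<mu> * \<mu> = \<rho>" using assms by (auto simp: \<mu>_def)
  have "Bseq (\<lambda>n. of_nat n * \<mu> ^ n)"
    using powser_times_n_limit_0[of \<mu>] \<mu> by (intro convergent_imp_Bseq convergentI) auto
  then obtain B where B: "B > 0" "\<And>n. norm (real n * \<mu> ^ n) \<le> B" by (auto elim: BseqE)
  have "summable (\<lambda>n. real (Suc n) * \<mu> ^ n)"
    using geometric_deriv_sums[of \<mu>] \<mu> by (auto simp: summable_def)
  then have "summable (\<lambda>n. (B + 1) * (real (Suc n) * \<mu> ^ n))"
    by (rule summable_mult)
  then have "summable (\<lambda>r. (real (Suc r))\<^sup>2 * \<rho> ^ (Suc r - 1))"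
  proof (rule summable_comparison_test')
    fix r :: nat
    have "(real (Suc r))\<^sup>2 * \<rho> ^ r = (real r * \<mu> ^ r + \<mu> ^ r) * (real (Suc r) * \<mu> ^ r)"
      by (simp add: \<mu>(3)[symmetric] power_mult_distrib power2_eq_square algebra_simps)
    also have "\<dots> \<le> (B + 1) * (real (Suc r) * \<mu> ^ r)"
      using B(2)[of r] \<mu> by (intro mult_right_mono add_mono) (auto simp: power_le_one)
    finally show "norm ((real (Suc r))\<^sup>2 * \<rho> ^ (Suc r - 1)) \<le> (B + 1) * (real (Suc r) * \<mu> ^ r)"
      using assms by simp
  qed
  then show ?thesis by (subst summable_Suc_iff[symmetric])
qed

lemma prob_satisfiable:
  "measure_pmf.prob p {F. satisfiable F} = 1 - measure_pmf.prob p {F. \<not> satisfiable F}"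
  using measure_pmf.prob_compl[of "{F. \<not> satisfiable F}" p]
  by (simp add: Compl_eq_Diff_UNIV[symmetric] Collect_neg_eq[symmetric])

text \<open>The weights may vary with n as long as they stay in one interval \<open>[1, R]\<close>;
  then the bicycle sum is bounded uniformly in n and the failure probability is O(1 / n).\<close>

theorem subcritical_2cnf_satisfiable:
  fixes D :: "nat \<Rightarrow> clause pmf" and m :: "nat \<Rightarrow> nat" and w :: "nat \<Rightarrow> literal \<Rightarrow> real"
  assumes "\<forall>\<^sub>F n in sequentially. set_pmf (D n) \<subseteq> k_clauses 2 n"
    and "\<forall>\<^sub>F n in sequentially. \<forall>C. real (m n) * pmf (D n) C \<le> K / real n"
    and w: "\<And>n a. a \<in> literals n \<Longrightarrow> 1 \<le> w n a" "\<And>n a. a \<in> literals n \<Longrightarrow> w n a \<le> R"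
    and "\<forall>\<^sub>F n in sequentially. \<forall>a\<in>literals n.
      real (m n) * (\<Sum>b\<in>literals n. pmf (D n) {neg a, b} * w n b) \<le> \<rho> * w n a"
    and \<rho>: "0 \<le> \<rho>" "\<rho> < 1"
  shows "(\<lambda>n. measure_pmf.prob (replicate_pmf (m n) (D n)) {F. satisfiable F}) \<longlonglongrightarrow> 1"
proof -
  define S where "S = (\<Sum>r. (real r)\<^sup>2 * \<rho> ^ (r - 1))"
  have R: "0 \<le> R" using w(1)[of "(1, True)" 1] w(2)[of "(1, True)" 1] by (simp add: literals_def)
  have "\<forall>\<^sub>F n in sequentially. measure_pmf.prob (replicate_pmf (m n) (D n)) {F. \<not> satisfiable F} \<le>
      4 * R * K\<^sup>2 * S / real n"
    using assms(1,2,5) eventually_gt_at_top[of 0]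
  proof eventually_elim
    case (elim n)
    have "measure_pmf.prob (replicate_pmf (m n) (D n)) {F. \<not> satisfiable F} \<le>
      4 * R * real n * (K / real n)\<^sup>2 * (\<Sum>r\<le>n. (real r)\<^sup>2 * \<rho> ^ (r - 1))"
      by (rule prob_unsat_le[where w = "w n"]) (use elim w R \<rho> in auto)
    also have "\<dots> \<le> 4 * R * real n * (K / real n)\<^sup>2 * S"
      unfolding S_def using R \<rho>
      by (intro mult_left_mono sum_le_suminf summable_square_geometric) auto
    also have "\<dots> = 4 * R * K\<^sup>2 * S / real n"
      using elim by (simp add: power2_eq_square field_simps)
    finally show ?case .
  qed
  then have "(\<lambda>n. measure_pmf.prob (replicate_pmf (m n) (D n)) {F. \<not> satisfiable F}) \<longlonglongrightarrow> 0"
    by (rule tendsto_sandwich[OF always_eventually _ tendsto_const lim_const_over_n, rotated]) simp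
  from tendsto_diff[OF tendsto_const this, of 1] show ?thesis
    by (simp add: prob_satisfiable)
qed

section \<open>Unsatisfiability by counting maximal assignments\<close>

lemma integral_pmf_indicator_combination:
  fixes c :: real and d :: "'v \<Rightarrow> real"
  shows "(\<integral>x. indicator A x * c + (\<Sum>v\<in>V. indicator (U v) x * d v) \<partial>measure_pmf p) =
    measure_pmf.prob p A * c + (\<Sum>v\<in>V. measure_pmf.prob p (U v) * d v)"
proof -
  have int: "integrable (measure_pmf p) (\<lambda>x. indicator S x * e)" for S and e :: real
    by (intro measure_pmf.integrable_const_bound[where B = "\<bar>e\<bar>"]) (auto simp: indicator_def)
  have val: "(\<integral>x. indicator S x * e \<partial>measure_pmf p) = measure_pmf.prob p S * e" for S and e :: real
    by simp
  show ?thesis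
    by (simp only: Bochner_Integration.integral_add[OF int Bochner_Integration.integrable_sum[OF int]]
        Bochner_Integration.integral_sum[OF int] val)
qed

text \<open>
  By induction on the number of draws: the first draw hits no box of \<open>V\<close> or exactly one, and the
  recursion closes because \<open>y\<^sup>f + f d y\<^sup>f\<^sup>-\<^sup>1 \<le> (y + d)\<^sup>f\<close>. No correlation inequality is needed.
\<close>

lemma prob_occupancy_le:
  fixes u b :: real
  assumes "finite V" "disjoint_family_on U V"
    and U: "\<And>v. v \<in> V \<Longrightarrow> U v \<subseteq> B" "\<And>v. v \<in> V \<Longrightarrow> measure_pmf.prob p (U v) = u"
    and B: "measure_pmf.prob p B = b" and "0 < b" "0 \<le> u" "u \<le> b"
  shows "measure_pmf.prob (replicate_pmf m p) {xs. set xs \<subseteq> B \<and> (\<forall>v\<in>V. U v \<inter> set xs \<noteq> {})}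
    \<le> b ^ m * (1 - (1 - u / b) ^ m) ^ card V"
  using assms(1-4)
proof (induction m arbitrary: V)
  case 0
  then show ?case by (cases "V = {}") (auto simp: power_0_left)
next
  case (Suc m)
  let ?Q = "\<lambda>V. measure_pmf.prob (replicate_pmf m p) {xs. set xs \<subseteq> B \<and> (\<forall>v\<in>V. U v \<inter> set xs \<noteq> {})}"
  define r where "r = u / b"
  \<comment> \<open>The probability that m draws hit a given box, conditioned on all draws lying in
    \<open>B\<close>. The claimed bound treats the boxes as if they were hit independently.\<close>
  define y where "y = 1 - (1 - r) ^ m"
  define f where "f = card V"
  have r: "0 \<le> r" "r \<le> 1" using assms by (auto simp: r_def divide_simps)
  have y: "0 \<le> y" "y \<le> 1" using r by (auto simp: y_def power_le_one)
  have fu: "measure_pmf.prob p (B - (\<Union>v\<in>V. U v)) = b - real f * u"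
  proof -
    have "measure_pmf.prob p (\<Union>v\<in>V. U v) = (\<Sum>v\<in>V. measure_pmf.prob p (U v))"
      using Suc.prems by (intro measure_pmf.finite_measure_finite_Union) auto
    also have "\<dots> = real f * u" using Suc.prems by (simp add: f_def)
    finally show ?thesis
      using Suc.prems B by (subst measure_pmf.finite_measure_Diff) auto
  qed
  have "measure_pmf.prob (replicate_pmf (Suc m) p) {xs. set xs \<subseteq> B \<and> (\<forall>v\<in>V. U v \<inter> set xs \<noteq> {})} \<le>
    (\<integral>x. indicator (B - (\<Union>v\<in>V. U v)) x * ?Q V + (\<Sum>v\<in>V. indicator (U v) x * ?Q (V - {v})) \<partial>measure_pmf p)"
    unfolding prob_replicate_pmf_Suc
  proof (rule integral_pmf_mono_bounded[where B = 1 and B' = "1 + real (card V)"])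
    fix x
    have nn: "0 \<le> (\<Sum>v\<in>V. indicator (U v) x * ?Q (V - {v}))"
      by (intro sum_nonneg) auto
    have "(\<Sum>v\<in>V. indicator (U v) x * ?Q (V - {v})) \<le> (\<Sum>v\<in>V. 1)"
      by (intro sum_mono) (auto simp: indicator_def)
    then have "(\<Sum>v\<in>V. indicator (U v) x * ?Q (V - {v})) \<le> real (card V)" by simp
    moreover have "0 \<le> indicator (B - (\<Union>v\<in>V. U v)) x * ?Q V"
      "indicator (B - (\<Union>v\<in>V. U v)) x * ?Q V \<le> 1"
      by (auto simp: indicator_def)
    ultimately show "\<bar>indicator (B - (\<Union>v\<in>V. U v)) x * ?Q V +
        (\<Sum>v\<in>V. indicator (U v) x * ?Q (V - {v}))\<bar> \<le> 1 + real (card V)"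
      using nn by linarith
    show "measure_pmf.prob (replicate_pmf m p)
          {xs. x # xs \<in> {xs. set xs \<subseteq> B \<and> (\<forall>v\<in>V. U v \<inter> set xs \<noteq> {})}}
        \<le> indicator (B - (\<Union>v\<in>V. U v)) x * ?Q V + (\<Sum>v\<in>V. indicator (U v) x * ?Q (V - {v}))"
      (is "?l \<le> _")
    proof (cases "\<exists>v\<in>V. x \<in> U v")
      case True
      then obtain v where v: "v \<in> V" "x \<in> U v" by auto
      have "?l \<le> ?Q (V - {v})"
      proof (intro measure_pmf.finite_measure_mono subsetI)
        fix xs assume xs: "xs \<in> {xs. x # xs \<in> {xs. set xs \<subseteq> B \<and> (\<forall>v\<in>V. U v \<inter> set xs \<noteq> {})}}"
        have "U v' \<inter> set xs \<noteq> {}" if v': "v' \<in> V - {v}" for v'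
        proof -
          have "x \<notin> U v'" using v' v Suc.prems(2) by (auto simp: disjoint_family_on_def)
          moreover have "U v' \<inter> set (x # xs) \<noteq> {}" using xs v' by blast
          ultimately show ?thesis by auto
        qed
        with xs show "xs \<in> {xs. set xs \<subseteq> B \<and> (\<forall>v\<in>V - {v}. U v \<inter> set xs \<noteq> {})}"
          by simp
      qed simp
      also have "\<dots> = indicator (U v) x * ?Q (V - {v})" using v by simp
      also have "\<dots> \<le> (\<Sum>v\<in>V. indicator (U v) x * ?Q (V - {v}))"
        using v Suc.prems(1) by (intro member_le_sum) auto
      also have "\<dots> \<le> indicator (B - (\<Union>v\<in>V. U v)) x * ?Q V + \<dots>" by simp
      finally show ?thesis .
    next
      case False
      show ?thesis
      proof (cases "x \<in> B")
        case True
        have "?l \<le> ?Q V"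
          using False by (intro measure_pmf.finite_measure_mono) (auto simp: Int_insert_right)
        also have "\<dots> = indicator (B - (\<Union>v\<in>V. U v)) x * ?Q V" using True False by simp
        finally show ?thesis using nn by linarith
      next
        case False
        then have "?l = 0" by simp
        then show ?thesis using nn by simp
      qed
    qed
  qed auto
  also have "\<dots> = (b - real f * u) * ?Q V + (\<Sum>v\<in>V. u * ?Q (V - {v}))"
    unfolding integral_pmf_indicator_combination fu using Suc.prems by simp
  also have "\<dots> \<le> (b - real f * u) * (b ^ m * y ^ f) + (\<Sum>v\<in>V. u * (b ^ m * y ^ (f - 1)))"
  proof (intro add_mono mult_left_mono sum_mono)
    show "?Q V \<le> b ^ m * y ^ f"
      using Suc by (simp add: y_def r_def f_def)
    show "0 \<le> b - real f * u" by (metis fu measure_nonneg)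
    fix v assume v: "v \<in> V"
    have "?Q (V - {v}) \<le> b ^ m * y ^ card (V - {v})"
      unfolding y_def r_def using Suc.prems
      by (intro Suc.IH) (auto simp: disjoint_family_on_def)
    then show "?Q (V - {v}) \<le> b ^ m * y ^ (f - 1)" using v Suc.prems by (simp add: f_def)
  qed (use assms in auto)
  also have "\<dots> = b ^ Suc m * ((1 - real f * r) * y ^ f + real f * r * y ^ (f - 1))"
  proof -
    have "u = b * r" using assms by (simp add: r_def)
    then show ?thesis by (simp add: f_def algebra_simps)
  qed
  \<comment> \<open>In this form the increment is \<open>r * (1 - y)\<close>, exactly the growth of
    the hitting probability from m to m + 1 draws.\<close>
  also have "(1 - real f * r) * y ^ f + real f * r * y ^ (f - 1) =
      y ^ f + real f * (r * (1 - y)) * y ^ (f - 1)"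
    by (cases f) (auto simp: algebra_simps)
  also have "b ^ Suc m * \<dots> \<le> b ^ Suc m * (y + r * (1 - y)) ^ f"
    using r y \<open>0 < b\<close> by (intro mult_left_mono add_power_ge) auto
  also have "y + r * (1 - y) = 1 - (1 - r) ^ Suc m"
    by (simp add: y_def algebra_simps)
  finally show ?case by (simp only: r_def f_def)
qed

text \<open>Once \<open>g\<close> prescribes the sign of each variable, a clause is determined by
  its set of variables. Falsified clauses, blocking clauses and clauses with prescribed positive
  literals are all counted this way.\<close>

lemma card_graph_clauses:
  "card {C \<in> k_clauses k n. (\<forall>(v, b)\<in>C. b = g v) \<and> P (fst ` C)} =
    card {A. A \<subseteq> {1..n} \<and> card A = k \<and> P A}"
proof (rule bij_betw_same_card[of "image fst"], rule bij_betwI[where g = "image (\<lambda>v. (v, g v))"])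
  show "image (\<lambda>v. (v, g v)) \<in> {A. A \<subseteq> {1..n} \<and> card A = k \<and> P A} \<rightarrow>
      {C \<in> k_clauses k n. (\<forall>(v, b)\<in>C. b = g v) \<and> P (fst ` C)}"
    by (auto simp: k_clauses_def card_image inj_on_def image_image)
  show "image fst \<in> {C \<in> k_clauses k n. (\<forall>(v, b)\<in>C. b = g v) \<and> P (fst ` C)} \<rightarrow>
      {A. A \<subseteq> {1..n} \<and> card A = k \<and> P A}"
    by (auto simp: k_clauses_def card_image)
  show "(\<lambda>v. (v, g v)) ` fst ` C = C"
    if "C \<in> {C \<in> k_clauses k n. (\<forall>(v, b)\<in>C. b = g v) \<and> P (fst ` C)}" for C
    using that by (force simp: image_iff)
  show "fst ` (\<lambda>v. (v, g v)) ` A = A" for A by (simp add: image_image)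
qed

lemma card_subsets_containing:
  assumes "v \<in> {1..n}" "0 < k"
  shows "card {A. A \<subseteq> {1..n} \<and> card A = k \<and> v \<in> A} = (n - 1) choose (k - 1)"
proof -
  have "card {A. A \<subseteq> {1..n} \<and> card A = k \<and> v \<in> A} = card {A. A \<subseteq> {1..n} - {v} \<and> card A = k - 1}"
    by (rule bij_betw_same_card[of "\<lambda>A. A - {v}"], rule bij_betwI[where g = "insert v"])
      (use assms in \<open>auto simp: card_insert_if finite_subset[of _ "{1..n} - {v}"] insert_absorb\<close>)
  also have "\<dots> = (n - 1) choose (k - 1)"
    using assms by (simp add: n_subsets)
  finally show ?thesis .
qed

definition true_clauses :: "nat \<Rightarrow> nat \<Rightarrow> nat set \<Rightarrow> clause set" where
  "true_clauses k n T = {C \<in> k_clauses k n. \<exists>(v, b)\<in>C. (v \<in> T) = b}"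

text \<open>For \<open>v\<close> outside \<open>T\<close> such a clause is satisfied only by
  \<open>(v, False)\<close>, so moving \<open>v\<close> into \<open>T\<close> falsifies it. These
  are the boxes of the occupancy bound; they are disjoint for different \<open>v\<close>.\<close>

definition blocking_clauses :: "nat \<Rightarrow> nat \<Rightarrow> nat set \<Rightarrow> nat \<Rightarrow> clause set" where
  "blocking_clauses k n T v = {C \<in> k_clauses k n. (v, False) \<in> C \<and> (\<forall>(x, b)\<in>C. x \<noteq> v \<longrightarrow> (x \<in> T) \<noteq> b)}"

lemma maximal_true_set:
  assumes F: "set F \<subseteq> k_clauses k n" and "satisfiable F"
  shows "\<exists>T\<subseteq>{1..n}. set F \<subseteq> true_clauses k n T \<and>
    (\<forall>v\<in>{1..n} - T. blocking_clauses k n T v \<inter> set F \<noteq> {})"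
proof -
  define P where "P T \<longleftrightarrow> T \<subseteq> {1..n} \<and> set F \<subseteq> true_clauses k n T" for T
  obtain \<sigma> where \<sigma>: "satisfies \<sigma> F" using \<open>satisfiable F\<close> by (auto simp: satisfiable_def)
  have "P {v \<in> {1..n}. \<sigma> v}"
    unfolding P_def
  proof (intro conjI subsetI)
    fix C assume "C \<in> set F"
    then obtain v b where "(v, b) \<in> C" "\<sigma> v = b" "C \<in> k_clauses k n"
      using \<sigma> F by (fastforce simp: satisfies_def)
    then show "C \<in> true_clauses k n {v \<in> {1..n}. \<sigma> v}"
      by (auto simp: true_clauses_def k_clauses_def intro!: bexI[of _ "(v, b)"])
  qed auto
  moreover have "\<forall>T. P T \<longrightarrow> card T < Suc n"
    using card_mono[of "{1..n}"] by (auto simp: P_def less_Suc_eq_le)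
  ultimately obtain T where T: "P T" and max: "\<And>T'. P T' \<Longrightarrow> card T' \<le> card T"
    using ex_has_greatest_nat[of P _ card "Suc n"] by blast
  have "blocking_clauses k n T v \<inter> set F \<noteq> {}" if v: "v \<in> {1..n} - T" for v
  proof -
    have "finite T" using T finite_subset by (auto simp: P_def)
    then have "\<not> P (insert v T)" using max[of "insert v T"] v by auto
    then obtain C where C: "C \<in> set F" "C \<notin> true_clauses k n (insert v T)"
      using T v by (auto simp: P_def)
    have K: "C \<in> k_clauses k n" "C \<in> true_clauses k n T" using C T F by (auto simp: P_def)
    then obtain w b where w: "(w, b) \<in> C" "(w \<in> T) = b" by (auto simp: true_clauses_def)
    have false: "(x \<in> insert v T) \<noteq> b'" if "(x, b') \<in> C" for x b'
      using that C(2) K(1) by (auto simp: true_clauses_def)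
    \<comment> \<open>Only \<open>v\<close> changes its value, so the literal that satisfied
      \<open>C\<close> before must be on \<open>v\<close>.\<close>
    have "w = v" using false[OF w(1)] w(2) by auto
    moreover have "b = False" using calculation w(2) v by simp
    ultimately have "(v, False) \<in> C" using w by simp
    moreover have "(x \<in> T) \<noteq> b'" if "(x, b') \<in> C" "x \<noteq> v" for x b'
      using false[OF that(1)] that(2) by simp
    ultimately show ?thesis using K C by (auto simp: blocking_clauses_def)
  qed
  with T show ?thesis by (auto simp: P_def)
qed

lemma card_false_clauses:
  "card (k_clauses k n - true_clauses k n T) = n choose k"
proof -
  have "k_clauses k n - true_clauses k n T =
      {C \<in> k_clauses k n. (\<forall>(v, b)\<in>C. b = (v \<notin> T)) \<and> True}"
    by (auto simp: true_clauses_def split: prod.splits)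
  then show ?thesis
    using card_graph_clauses[of k n "\<lambda>v. v \<notin> T" "\<lambda>_. True"] by (simp add: n_subsets)
qed

lemma card_blocking_clauses:
  assumes "v \<in> {1..n} - T" "0 < k"
  shows "card (blocking_clauses k n T v) = (n - 1) choose (k - 1)"
proof -
  have "blocking_clauses k n T v =
      {C \<in> k_clauses k n. (\<forall>(x, b)\<in>C. b = (x \<noteq> v \<and> x \<notin> T)) \<and> v \<in> fst ` C}"
    unfolding blocking_clauses_def
  proof (rule Collect_cong, rule conj_cong[OF refl])
    fix C assume C: "C \<in> k_clauses k n"
    show "((v, False) \<in> C \<and> (\<forall>(x, b)\<in>C. x \<noteq> v \<longrightarrow> (x \<in> T) \<noteq> b)) \<longleftrightarrow>
        (\<forall>(x, b)\<in>C. b = (x \<noteq> v \<and> x \<notin> T)) \<and> v \<in> fst ` C" (is "?l \<longleftrightarrow> ?r")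
    proof
      assume l: ?l
      have "b = (x \<noteq> v \<and> x \<notin> T)" if "(x, b) \<in> C" for x b
      proof (cases "x = v")
        case True
        then have "(x, b) = (v, False)"
          using C l that by (intro inj_onD[of fst C]) (auto simp: k_clauses_def)
        then show ?thesis by simp
      next
        case False
        with l that show ?thesis by blast
      qed
      moreover have "v \<in> fst ` C" using l by (metis fst_conv image_eqI)
      ultimately show ?r by blast
    next
      assume r: ?r
      then have "v \<in> fst ` C" by (rule conjunct2)
      then obtain b where "(v, b) \<in> C" by auto
      have eq: "b = (x \<noteq> v \<and> x \<notin> T)" if "(x, b) \<in> C" for x b
        using bspec[OF conjunct1[OF r] that] by simp
      have "(v, False) \<in> C" using eq[OF \<open>(v, b) \<in> C\<close>] \<open>(v, b) \<in> C\<close> by simp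
      moreover have "(x \<in> T) \<noteq> b" if "(x, b) \<in> C" "x \<noteq> v" for x b
        using eq[OF that(1)] that(2) by simp
      ultimately show ?l by blast
    qed
  qed
  then show ?thesis
    using card_subsets_containing[of v n k] assms
      card_graph_clauses[of k n "\<lambda>x. x \<noteq> v \<and> x \<notin> T" "\<lambda>A. v \<in> A"] by simp
qed

lemma k_clauses_nonempty:
  assumes "k \<le> n" shows "k_clauses k n \<noteq> {}"
  using card_k_clauses[of k n] assms by (auto simp del: card_eq_0_iff)

lemma prob_random_clause:
  assumes "k \<le> n" "A \<subseteq> k_clauses k n"
  shows "measure_pmf.prob (random_clause k n) A = card A / (2 ^ k * (n choose k))"
  using assms k_clauses_nonempty[of k n] finite_k_clauses[of k n]
  by (simp add: random_clause_def measure_pmf_of_set card_k_clauses Int_absorb1)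

text \<open>Given that a clause is true, it blocks a fixed false variable with probability
  \<open>u / b\<close>, which is k / ((2^k - 1) n). A set \<open>T\<close> thus costs
  \<open>b ^ m\<close> and one factor y per false variable, and summing over all \<open>T\<close>
  gives (1 + y)^n.\<close>

lemma prob_satisfiable_le:
  assumes k: "0 < k" "k \<le> n"
  defines "b \<equiv> 1 - 1 / 2 ^ k"
  shows "measure_pmf.prob (random_formula k n m) {F. satisfiable F} \<le>
    b ^ m * (2 - (1 - real k / (2 ^ k - 1) / real n) ^ m) ^ n"
proof -
  let ?p = "random_clause k n"
  let ?P = "measure_pmf.prob (random_formula k n m)"
  define u where "u = real k / (real n * 2 ^ k)"
  define y where "y = 1 - (1 - u / b) ^ m"
  define G where "G T = {F. set F \<subseteq> true_clauses k n T \<and>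
    (\<forall>v\<in>{1..n} - T. blocking_clauses k n T v \<inter> set F \<noteq> {})}" for T
  have k2: "(2::real) ^ k \<ge> 2" using power_increasing[of 1 k "2::real"] k by simp
  have b: "0 < b" using k2 by (simp add: b_def)
  have ub: "u / b = real k / (2 ^ k - 1) / real n"
    using k2 by (simp add: u_def b_def divide_simps)
  have pb: "measure_pmf.prob ?p (true_clauses k n T) = b" for T
  proof -
    have "measure_pmf.prob ?p (k_clauses k n) = 1"
      using k by (simp add: prob_random_clause card_k_clauses binomial_eq_0_iff)
    moreover have "measure_pmf.prob ?p (k_clauses k n - true_clauses k n T) = 1 / 2 ^ k"
      using k by (simp add: prob_random_clause card_false_clauses binomial_eq_0_iff)
    moreover have "true_clauses k n T \<subseteq> k_clauses k n" by (auto simp: true_clauses_def)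
    ultimately show ?thesis
      by (simp add: measure_pmf.finite_measure_Diff b_def)
  qed
  have pu: "measure_pmf.prob ?p (blocking_clauses k n T v) = u" if "v \<in> {1..n} - T" for T v
  proof -
    have "real k * (n choose k) = real n * ((n - 1) choose (k - 1))"
      using binomial_absorption[of "k - 1" n] k by (simp flip: of_nat_mult)
    then have "real ((n - 1) choose (k - 1)) / (2 ^ k * (n choose k)) = u"
      using k by (simp add: u_def field_simps)
    moreover have "blocking_clauses k n T v \<subseteq> k_clauses k n" by (auto simp: blocking_clauses_def)
    ultimately show ?thesis
      using k that by (simp add: prob_random_clause card_blocking_clauses)
  qed
  \<comment> \<open>The case \<open>T = {}\<close>, \<open>v = 1\<close> shows the inequality
    through inclusion of events.\<close>
  have u: "0 \<le> u" "u \<le> b"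
  proof -
    have sub: "blocking_clauses k n {} 1 \<subseteq> true_clauses k n {}"
      by (auto simp: blocking_clauses_def true_clauses_def)
    show "u \<le> b"
      using measure_pmf.finite_measure_mono[OF sub, of ?p] pb[of "{}"] pu[of 1 "{}"] k by simp
  qed (simp add: u_def)
  have "?P {F. satisfiable F} = ?P ({F. satisfiable F} \<inter> set_pmf (random_formula k n m))"
    by (simp add: measure_Int_set_pmf)
  also have "\<dots> \<le> ?P (\<Union>T\<in>Pow {1..n}. G T)"
  proof (intro measure_pmf.finite_measure_mono subsetI)
    fix F assume F: "F \<in> {F. satisfiable F} \<inter> set_pmf (random_formula k n m)"
    then have "set F \<subseteq> k_clauses k n"
      using k_clauses_nonempty[OF k(2)] finite_k_clauses[of k n]
      by (auto simp: random_formula_def random_clause_def set_replicate_pmf)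
    from maximal_true_set[OF this] F show "F \<in> (\<Union>T\<in>Pow {1..n}. G T)"
      by (auto simp: G_def)
  qed simp
  also have "\<dots> \<le> (\<Sum>T\<in>Pow {1..n}. ?P (G T))"
    by (intro measure_pmf.finite_measure_subadditive_finite) auto
  also have "\<dots> \<le> (\<Sum>T\<in>Pow {1..n}. b ^ m * y ^ card ({1..n} - T))"
  proof (rule sum_mono)
    fix T assume "T \<in> Pow {1..n}"
    show "?P (G T) \<le> b ^ m * y ^ card ({1..n} - T)"
      unfolding G_def y_def random_formula_def
    proof (rule prob_occupancy_le)
      show "disjoint_family_on (blocking_clauses k n T) ({1..n} - T)"
        by (fastforce simp: disjoint_family_on_def blocking_clauses_def)
      show "blocking_clauses k n T v \<subseteq> true_clauses k n T" if "v \<in> {1..n} - T" for v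
        using that by (auto simp: blocking_clauses_def true_clauses_def)
    qed (use u b pb pu in auto)
  qed
  also have "\<dots> = b ^ m * (\<Sum>T\<in>Pow {1..n}. (\<Prod>i\<in>T. 1) * (\<Prod>i\<in>{1..n} - T. y))"
    by (simp add: sum_distrib_left)
  also have "\<dots> = b ^ m * (1 + y) ^ n"
    by (subst prod_add[symmetric]) auto
  finally show ?thesis by (simp add: y_def ub)
qed

text \<open>Up to the factor \<open>1 / b\<close> lost by rounding m down, the n-th root of the
  finite bound converges to the left side of \<open>less\<close>. Any \<open>q\<close> strictly
  between that limit and 1 yields geometric decay.\<close>

theorem random_formula_unsatisfiable:
  fixes \<alpha> :: real
  assumes "0 < k" "0 < \<alpha>"
    and less: "(1 - 1 / 2 ^ k) powr \<alpha> * (2 - exp (- (real k / (2 ^ k - 1) * \<alpha>))) < 1"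
  shows "(\<lambda>n. measure_pmf.prob (random_formula k n (nat \<lfloor>\<alpha> * real n\<rfloor>)) {F. \<not> satisfiable F}) \<longlonglongrightarrow> 1"
proof -
  define b :: real where "b = 1 - 1 / 2 ^ k"
  define c :: real where "c = real k / (2 ^ k - 1)"
  define m where "m n = nat \<lfloor>\<alpha> * real n\<rfloor>" for n :: nat
  have k2: "(2::real) ^ k \<ge> 2" using power_increasing[of 1 k "2::real"] assms by simp
  have b: "0 < b" "b < 1" using k2 by (auto simp: b_def)
  have c: "0 < c" using k2 assms by (auto simp: c_def)
  have lim: "(\<lambda>n. b powr \<alpha> * (2 - (1 - c / real n) powr (\<alpha> * real n))) \<longlonglongrightarrow> b powr \<alpha> * (2 - exp (- (c * \<alpha>)))"
  proof -
    have "((\<lambda>n. (1 + (- c) / real n) ^ n) \<longlonglongrightarrow> exp (- c))"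
      by (rule tendsto_exp_limit_sequentially)
    then have "(\<lambda>n. ((1 + (- c) / real n) ^ n) powr \<alpha>) \<longlonglongrightarrow> exp (- c) powr \<alpha>"
      by (intro tendsto_intros) auto
    moreover have "\<forall>\<^sub>F n in sequentially. ((1 + (- c) / real n) ^ n) powr \<alpha> = (1 - c / real n) powr (\<alpha> * real n)"
      using eventually_gt_at_top[of "nat \<lceil>c\<rceil>"]
    proof eventually_elim
      case (elim n)
      then have "c < real n" by linarith
      then have "0 < 1 - c / real n" using c by (simp add: field_simps)
      then show ?case by (simp add: powr_powr mult.commute flip: powr_realpow)
    qed
    ultimately have "(\<lambda>n. (1 - c / real n) powr (\<alpha> * real n)) \<longlonglongrightarrow> exp (- c) powr \<alpha>"
      by (rule Lim_transform_eventually)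
    then show ?thesis by (intro tendsto_intros) (simp add: powr_def mult.commute)
  qed
  define q where "q = (b powr \<alpha> * (2 - exp (- (c * \<alpha>))) + 1) / 2"
  have q: "b powr \<alpha> * (2 - exp (- (c * \<alpha>))) < q" "q < 1"
    using less by (auto simp: q_def b_def c_def)
  have "0 \<le> 2 - exp (- (c * \<alpha>))" using c assms by (smt (verit) exp_le_one_iff mult_nonneg_nonneg)
  then have q0: "0 \<le> q" using q(1) by (smt (verit) powr_ge_zero mult_nonneg_nonneg)
  have "\<forall>\<^sub>F n in sequentially. measure_pmf.prob (random_formula k n (m n)) {F. satisfiable F} \<le> 1 / b * q ^ n"
    using order_tendstoD(2)[OF lim q(1)] eventually_gt_at_top[of "nat \<lceil>c\<rceil>"] eventually_ge_at_top[of k]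
  proof eventually_elim
    case (elim n)
    have cn: "c < real n" using elim by linarith
    then have d: "0 < 1 - c / real n" "1 - c / real n \<le> 1" using c by (auto simp: field_simps)
    have m: "real (m n) \<le> \<alpha> * real n" "\<alpha> * real n - 1 \<le> real (m n)"
      using assms by (auto simp: m_def)
    have "measure_pmf.prob (random_formula k n (m n)) {F. satisfiable F} \<le>
        b ^ m n * (2 - (1 - c / real n) ^ m n) ^ n"
      using prob_satisfiable_le[of k n "m n"] assms elim by (simp add: b_def c_def)
    also have "\<dots> \<le> (1 / b * (b powr \<alpha>) ^ n) * (2 - (1 - c / real n) powr (\<alpha> * real n)) ^ n"
    proof (intro mult_mono power_mono diff_left_mono)
      have "b ^ m n = b powr real (m n)" using b by (simp add: powr_realpow)
      also have "\<dots> \<le> b powr (\<alpha> * real n - 1)" using b m by (intro powr_mono') auto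
      also have "\<dots> = 1 / b * (b powr \<alpha>) ^ n"
        using b by (simp add: powr_diff powr_powr flip: powr_realpow)
      finally show "b ^ m n \<le> 1 / b * (b powr \<alpha>) ^ n" .
      have "(1 - c / real n) powr (\<alpha> * real n) \<le> (1 - c / real n) powr real (m n)"
        using d m by (intro powr_mono') auto
      then show "(1 - c / real n) powr (\<alpha> * real n) \<le> (1 - c / real n) ^ m n"
        using d by (simp add: powr_realpow)
      show "0 \<le> 2 - (1 - c / real n) ^ m n" using power_le_one[of "1 - c / real n" "m n"] d by simp
      then show "0 \<le> (2 - (1 - c / real n) ^ m n) ^ n" by simp
    qed (use b in auto)
    also have "\<dots> = 1 / b * (b powr \<alpha> * (2 - (1 - c / real n) powr (\<alpha> * real n))) ^ n"
      by (simp add: power_mult_distrib)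
    also have "\<dots> \<le> 1 / b * q ^ n"
    proof (intro mult_left_mono power_mono)
      have "(1 - c / real n) powr (\<alpha> * real n) \<le> 1 powr (\<alpha> * real n)"
        using d assms by (intro powr_mono2) auto
      then show "0 \<le> b powr \<alpha> * (2 - (1 - c / real n) powr (\<alpha> * real n))" by simp
    qed (use elim b in auto)
    finally show ?case .
  qed
  moreover have "(\<lambda>n. 1 / b * q ^ n) \<longlonglongrightarrow> 1 / b * 0"
    using q q0 by (intro tendsto_intros LIMSEQ_realpow_zero) auto
  then have "(\<lambda>n. 1 / b * q ^ n) \<longlonglongrightarrow> 0" by simp
  ultimately have "(\<lambda>n. measure_pmf.prob (random_formula k n (m n)) {F. satisfiable F}) \<longlonglongrightarrow> 0"
    by (rule tendsto_sandwich[OF always_eventually _ tendsto_const, rotated]) simp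
  from tendsto_diff[OF tendsto_const this, of 1] show ?thesis
    by (simp add: prob_satisfiable m_def)
qed

section \<open>Memoryless selection by rank\<close>

lemma prob_replicate_pmf_subset:
  "measure_pmf.prob (replicate_pmf t p) {xs. set xs \<subseteq> A} = measure_pmf.prob p A ^ t"
proof (induction t)
  case (Suc t)
  have "measure_pmf.prob (replicate_pmf t p) {xs. x # xs \<in> {xs. set xs \<subseteq> A}} =
      indicator A x * measure_pmf.prob p A ^ t" for x
    using Suc by (cases "x \<in> A") auto
  then show ?case unfolding prob_replicate_pmf_Suc by simp
qed simp

lemma map_replicate_pmf: "map_pmf (map f) (replicate_pmf t p) = replicate_pmf t (map_pmf f p)"
proof (induction t)
  case (Suc t)
  show ?case
    by (simp add: Suc[symmetric] map_bind_pmf bind_map_pmf)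
qed simp

lemma achlioptas_formula_memoryless:
  "achlioptas_formula t k n (\<lambda>h. f) m = replicate_pmf m (map_pmf f (replicate_pmf t (random_clause k n)))"
proof (induction m)
  case 0
  show ?case by (simp add: achlioptas_formula_def)
next
  case (Suc m)
  let ?p = "map_pmf f (replicate_pmf t (random_clause k n))"
  have "achlioptas_formula t k n (\<lambda>h. f) (Suc m) =
      bind_pmf (achlioptas_formula t k n (\<lambda>h. f) m) (\<lambda>F. map_pmf (\<lambda>C. F @ [C]) ?p)"
    by (simp add: achlioptas_formula_def map_bind_pmf bind_map_pmf map_pmf_def bind_assoc_pmf bind_return_pmf)
  \<comment> \<open>The process appends the new clause at the end, whereas
    \<open>replicate_pmf\<close> adds it in front; splitting off the last of m + 1 independent draws
    reconciles the two.\<close>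
  also have "\<dots> = replicate_pmf (m + 1) ?p"
    unfolding Suc replicate_pmf_distrib replicate_pmf_1 by (simp add: map_pmf_def bind_assoc_pmf bind_return_pmf)
  finally show ?case by simp
qed

text \<open>The law of a single step. Low rank is preferred and ties go to the clause presented
  first. Here \<rho> is a rank, not a contraction factor.\<close>

definition selected :: "(clause \<Rightarrow> nat) \<Rightarrow> nat \<Rightarrow> nat \<Rightarrow> clause pmf" where
  "selected \<rho> k n = map_pmf (arg_min_list \<rho>) (replicate_pmf 3 (random_clause k n))"

lemma set_random_clause: "k \<le> n \<Longrightarrow> set_pmf (random_clause k n) = k_clauses k n"
  by (simp add: random_clause_def k_clauses_nonempty finite_k_clauses)

lemma set_selected:
  assumes "k \<le> n"
  shows "set_pmf (selected \<rho> k n) \<subseteq> k_clauses k n"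
proof
  fix C assume "C \<in> set_pmf (selected \<rho> k n)"
  then obtain xs where "C = arg_min_list \<rho> xs" "set xs \<subseteq> k_clauses k n" "length xs = 3"
    using assms by (auto simp: selected_def set_replicate_pmf set_random_clause)
  then show "C \<in> k_clauses k n" using arg_min_list_in[of xs \<rho>] by (cases xs) auto
qed

text \<open>The minimum of three ranks is at least r exactly when all three are, whence the
  cube.\<close>

lemma prob_selected_ge:
  assumes "k \<le> n"
  shows "measure_pmf.prob (selected \<rho> k n) {C. r \<le> \<rho> C} =
    (card {C \<in> k_clauses k n. r \<le> \<rho> C} / card (k_clauses k n)) ^ 3"
proof -
  have "measure_pmf.prob (selected \<rho> k n) {C. r \<le> \<rho> C} =
      measure_pmf.prob (replicate_pmf 3 (random_clause k n)) {xs. set xs \<subseteq> {C. r \<le> \<rho> C}}"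
    unfolding selected_def measure_map_pmf
  proof (intro measure_pmf.finite_measure_eq_AE AE_pmfI)
    fix xs assume "xs \<in> set_pmf (replicate_pmf 3 (random_clause k n))"
    then have "xs \<noteq> []" by (auto simp: set_replicate_pmf)
    then show "xs \<in> arg_min_list \<rho> -` {C. r \<le> \<rho> C} \<longleftrightarrow> xs \<in> {xs. set xs \<subseteq> {C. r \<le> \<rho> C}}"
      by (auto simp: f_arg_min_list_f)
  qed auto
  also have "\<dots> = (card {C \<in> k_clauses k n. r \<le> \<rho> C} / card (k_clauses k n)) ^ 3"
    using k_clauses_nonempty[OF assms] finite_k_clauses[of k n]
    by (simp only: prob_replicate_pmf_subset) (simp add: random_clause_def measure_pmf_of_set Int_def)
  finally show ?thesis .
qed

lemma arg_min_list_map: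
  assumes "\<And>x. \<rho> (\<tau> x) = \<rho> x" "xs \<noteq> []"
  shows "arg_min_list \<rho> (map \<tau> xs) = \<tau> (arg_min_list \<rho> xs)"
  using assms(2) by (induction xs rule: induct_list012) (auto simp: assms(1) Let_def)

text \<open>Such a \<tau> preserves the uniform law of each presented clause and every comparison of
  ranks, ties included. It is applied to swaps of two clauses and to renamings of variables.\<close>

lemma map_selected:
  assumes "k \<le> n" and \<tau>: "bij_betw \<tau> (k_clauses k n) (k_clauses k n)" "\<And>C. \<rho> (\<tau> C) = \<rho> C"
  shows "map_pmf \<tau> (selected \<rho> k n) = selected \<rho> k n"
proof -
  have "map_pmf \<tau> (selected \<rho> k n) =
      map_pmf (\<lambda>xs. arg_min_list \<rho> (map \<tau> xs)) (replicate_pmf 3 (random_clause k n))"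
    unfolding selected_def map_pmf_comp
    by (intro map_pmf_cong refl arg_min_list_map[symmetric]) (auto simp: \<tau>(2) set_replicate_pmf)
  also have "\<dots> = map_pmf (arg_min_list \<rho>) (map_pmf (map \<tau>) (replicate_pmf 3 (random_clause k n)))"
    by (simp add: map_pmf_comp)
  also have "\<dots> = selected \<rho> k n"
    unfolding map_replicate_pmf selected_def random_clause_def
    by (simp add: map_pmf_of_set_bij_betw[OF \<tau>(1)] k_clauses_nonempty[OF assms(1)] finite_k_clauses)
  finally show ?thesis .
qed

text \<open>
  Swapping two clauses of equal rank commutes with the selection rule.
\<close>

lemma pmf_selected_eq:
  assumes "k \<le> n" "C \<in> k_clauses k n" "C' \<in> k_clauses k n" "\<rho> C = \<rho> C'"
  shows "pmf (selected \<rho> k n) C = pmf (selected \<rho> k n) C'"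
proof -
  let ?\<tau> = "Transposition.transpose C C'"
  have "map_pmf ?\<tau> (selected \<rho> k n) = selected \<rho> k n"
    using assms by (intro map_selected) (auto simp: Transposition.transpose_def)
  then show ?thesis
    using pmf_map_inj'[of ?\<tau> "selected \<rho> k n" C] by (simp add: inj_transpose)
qed

lemma prob_level:
  fixes \<rho> :: "'a \<Rightarrow> nat"
  shows "measure_pmf.prob p {x. \<rho> x = r} =
    measure_pmf.prob p {x. r \<le> \<rho> x} - measure_pmf.prob p {x. Suc r \<le> \<rho> x}"
proof -
  have "{x. \<rho> x = r} = {x. r \<le> \<rho> x} - {x. Suc r \<le> \<rho> x}" by auto
  then show ?thesis by (simp add: measure_pmf.finite_measure_Diff subset_eq)
qed

lemma pmf_constant_on_level:
  fixes \<rho> :: "'a \<Rightarrow> nat"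
  assumes "finite K" "set_pmf p \<subseteq> K" "x \<in> K"
    and "\<And>y. y \<in> K \<Longrightarrow> \<rho> y = \<rho> x \<Longrightarrow> pmf p y = pmf p x"
  shows "pmf p x * real (card {y \<in> K. \<rho> y = \<rho> x}) = measure_pmf.prob p {y. \<rho> y = \<rho> x}"
proof -
  have "measure_pmf.prob p {y. \<rho> y = \<rho> x} = measure_pmf.prob p {y \<in> K. \<rho> y = \<rho> x}"
    using assms(2) by (intro measure_pmf.finite_measure_eq_AE AE_pmfI) auto
  also have "\<dots> = (\<Sum>y\<in>{y \<in> K. \<rho> y = \<rho> x}. pmf p y)"
    using assms(1) by (intro measure_measure_pmf_finite) auto
  also have "\<dots> = (\<Sum>y\<in>{y \<in> K. \<rho> y = \<rho> x}. pmf p x)"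
    using assms(4) by (intro sum.cong) auto
  finally show ?thesis by simp
qed

text \<open>A rank level has mass a^3 - b^3 for consecutive tails a and b, shared equally by a
  fraction a - b of all clauses. The quotient a^2 + a b + b^2 increases in both tails, so upper
  bounds on tails give upper bounds on point masses.\<close>

lemma pmf_selected:
  fixes \<rho> :: "clause \<Rightarrow> nat"
  assumes "k \<le> n" "C \<in> k_clauses k n"
  defines "H \<equiv> \<lambda>r. real (card {C \<in> k_clauses k n. r \<le> \<rho> C}) / card (k_clauses k n)"
  shows "pmf (selected \<rho> k n) C =
    ((H (\<rho> C))\<^sup>2 + H (\<rho> C) * H (Suc (\<rho> C)) + (H (Suc (\<rho> C)))\<^sup>2) / card (k_clauses k n)"
proof -
  let ?N = "real (card (k_clauses k n))"
  let ?A = "{C' \<in> k_clauses k n. \<rho> C' = \<rho> C}"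
  have N: "?N > 0" using k_clauses_nonempty[OF assms(1)] finite_k_clauses[of k n] by (simp add: card_gt_0_iff)
  have A: "card ?A > 0" using assms finite_k_clauses[of k n] by (auto simp: card_gt_0_iff)
  have "{C' \<in> k_clauses k n. \<rho> C \<le> \<rho> C'} = ?A \<union> {C' \<in> k_clauses k n. Suc (\<rho> C) \<le> \<rho> C'}" by auto
  then have "card {C' \<in> k_clauses k n. \<rho> C \<le> \<rho> C'} = card ?A + card {C' \<in> k_clauses k n. Suc (\<rho> C) \<le> \<rho> C'}"
    using finite_k_clauses[of k n] by (simp add: card_Un_disjoint disjoint_iff)
  then have diff: "H (\<rho> C) - H (Suc (\<rho> C)) = card ?A / ?N"
    by (simp add: H_def add_divide_distrib)
  have "pmf (selected \<rho> k n) C * card ?A = measure_pmf.prob (selected \<rho> k n) {C'. \<rho> C' = \<rho> C}"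
    by (rule pmf_constant_on_level[OF finite_k_clauses set_selected[OF assms(1)] assms(2)])
      (rule pmf_selected_eq[OF assms(1) _ assms(2)])
  also have "\<dots> = H (\<rho> C) ^ 3 - H (Suc (\<rho> C)) ^ 3"
    unfolding prob_level prob_selected_ge[OF assms(1)] H_def ..
  also have "\<dots> = (H (\<rho> C) - H (Suc (\<rho> C))) *
      ((H (\<rho> C))\<^sup>2 + H (\<rho> C) * H (Suc (\<rho> C)) + (H (Suc (\<rho> C)))\<^sup>2)"
    by (simp add: power2_eq_square power3_eq_cube algebra_simps)
  finally have eq: "pmf (selected \<rho> k n) C * card ?A = card ?A / ?N *
      ((H (\<rho> C))\<^sup>2 + H (\<rho> C) * H (Suc (\<rho> C)) + (H (Suc (\<rho> C)))\<^sup>2)"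
    unfolding diff .
  have "p = x / N" if "0 < a" "0 < N" "p * a = a / N * x" for p a N x :: real
    using that by (simp add: field_simps)
  from this[OF _ N eq] A show ?thesis by simp
qed

text \<open>A coupling: each clause is drawn together with its shrunken version, and any assignment
  satisfying all shrunken clauses satisfies the originals.\<close>

lemma prob_satisfiable_shrink:
  assumes sub: "\<And>C q. C \<in> set_pmf p \<Longrightarrow> q \<in> set_pmf (f C) \<Longrightarrow> q \<subseteq> C"
  shows "measure_pmf.prob (replicate_pmf m (bind_pmf p f)) {F. satisfiable F} \<le>
    measure_pmf.prob (replicate_pmf m p) {F. satisfiable F}"
proof -
  define Q where "Q = bind_pmf p (\<lambda>C. map_pmf (Pair C) (f C))"
  have 1: "replicate_pmf m p = map_pmf (map fst) (replicate_pmf m Q)"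
    unfolding map_replicate_pmf by (simp add: Q_def map_bind_pmf map_pmf_comp bind_return_pmf')
  have 2: "replicate_pmf m (bind_pmf p f) = map_pmf (map snd) (replicate_pmf m Q)"
    unfolding map_replicate_pmf by (simp add: Q_def map_bind_pmf map_pmf_comp)
  have "satisfiable (map fst xs)" if "xs \<in> set_pmf (replicate_pmf m Q)" "satisfiable (map snd xs)" for xs
  proof -
    have "snd x \<subseteq> fst x" if "x \<in> set xs" for x
      using that \<open>xs \<in> _\<close> sub by (fastforce simp: set_replicate_pmf Q_def)
    note sub' = this
    have "satisfies \<sigma> (map fst xs)" if \<sigma>: "satisfies \<sigma> (map snd xs)" for \<sigma>
      unfolding satisfies_def
    proof
      fix C assume "C \<in> set (map fst xs)"
      then obtain x where x: "x \<in> set xs" "C = fst x" by auto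
      then have "\<exists>(v, b)\<in>snd x. \<sigma> v = b" using \<sigma> by (simp add: satisfies_def)
      then obtain l where "l \<in> snd x" "case l of (v, b) \<Rightarrow> \<sigma> v = b" by (rule bexE)
      then show "\<exists>(v, b)\<in>C. \<sigma> v = b" using sub'[OF x(1)] x(2) by (intro bexI[of _ l]) auto
    qed
    with that(2) show ?thesis by (auto simp: satisfiable_def)
  qed
  then show ?thesis
    unfolding 1 2 measure_map_pmf
    by (intro measure_pmf.finite_measure_mono_AE AE_pmfI) auto
qed

section \<open>Counting clauses by their positive literals\<close>

definition npos :: "clause \<Rightarrow> nat" where
  "npos C = card {l \<in> C. snd l}"

lemma k_clauses_finite: "C \<in> k_clauses k n \<Longrightarrow> finite C"
  unfolding k_clauses_def by (auto dest: finite_subset)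

lemma card_npos_0: "card {C \<in> k_clauses k n. npos C = 0} = n choose k"
proof -
  have "{C \<in> k_clauses k n. npos C = 0} = {C \<in> k_clauses k n. (\<forall>(v, b)\<in>C. b = False) \<and> True}"
    by (auto simp: npos_def k_clauses_finite card_eq_0_iff)
  then show ?thesis using card_graph_clauses[of k n "\<lambda>_. False" "\<lambda>_. True"] by (simp add: n_subsets)
qed

text \<open>Split by the unique positive variable, which forces all signs; then n * C(n - 1, k - 1)
  = k * C(n, k).\<close>

lemma card_npos_1:
  assumes "0 < k"
  shows "card {C \<in> k_clauses k n. npos C = 1} = k * (n choose k)"
proof -
  define X where "X v = {C \<in> k_clauses k n. (\<forall>(x, b)\<in>C. b = (x = v)) \<and> v \<in> fst ` C}" for v
  have X: "C \<in> X v \<longleftrightarrow> C \<in> k_clauses k n \<and> {l \<in> C. snd l} = {(v, True)}" for C v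
  proof (cases "C \<in> k_clauses k n")
    case True
    then have no_both: "(v, True) \<in> C \<Longrightarrow> (v, False) \<notin> C"
      by (auto simp: k_clauses_def dest: inj_onD[of fst C "(v, True)" "(v, False)"])
    have "((\<forall>(x, b)\<in>C. b = (x = v)) \<and> v \<in> fst ` C) \<longleftrightarrow> {l \<in> C. snd l} = {(v, True)}" (is "?l \<longleftrightarrow> ?r")
    proof
      assume l: ?l
      have eq: "b = (x = v)" if "(x, b) \<in> C" for x b
        using bspec[OF conjunct1[OF l] that] by simp
      from l have "v \<in> fst ` C" by (rule conjunct2)
      then obtain b where "(v, b) \<in> C" by auto
      then have "(v, True) \<in> C" using eq[of v b] by simp
      then show ?r using eq by auto
    next
      assume r: ?r
      then have mem: "(v, True) \<in> C" by blast
      have "b = (x = v)" if "(x, b) \<in> C" for x b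
      proof (cases b)
        case True
        then have "(x, b) \<in> {l \<in> C. snd l}" using that by simp
        then show ?thesis using r True by simp
      next
        case False
        then show ?thesis using no_both[OF mem] that by auto
      qed
      then show ?l using mem by force
    qed
    with True show ?thesis by (simp add: X_def)
  qed (simp add: X_def)
  have "{C \<in> k_clauses k n. npos C = 1} = (\<Union>v\<in>{1..n}. X v)"
  proof (intro equalityI subsetI)
    fix C assume C: "C \<in> {C \<in> k_clauses k n. npos C = 1}"
    then obtain l where l: "{l \<in> C. snd l} = {l}" by (auto simp: npos_def card_1_singleton_iff)
    then have "l \<in> {l \<in> C. snd l}" by simp
    then have "l = (fst l, True)" "l \<in> C" by (auto simp: prod_eq_iff)
    moreover have "C \<in> k_clauses k n" using C by simp
    moreover have "fst l \<in> {1..n}"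
      using calculation(2,3) by (auto simp: k_clauses_def)
    ultimately show "C \<in> (\<Union>v\<in>{1..n}. X v)" using l X[of C "fst l"] by (metis UN_I)
  next
    fix C assume "C \<in> (\<Union>v\<in>{1..n}. X v)"
    then obtain v where "C \<in> X v" by (rule UN_E)
    then show "C \<in> {C \<in> k_clauses k n. npos C = 1}" using X[of C v] by (simp add: npos_def)
  qed
  moreover have "card (\<Union>v\<in>{1..n}. X v) = (\<Sum>v\<in>{1..n}. card (X v))"
  proof (rule card_UN_disjoint)
    show "\<forall>v\<in>{1..n}. finite (X v)" using finite_k_clauses[of k n] by (simp add: X_def)
    show "\<forall>v\<in>{1..n}. \<forall>w\<in>{1..n}. v \<noteq> w \<longrightarrow> X v \<inter> X w = {}"
    proof (intro ballI impI)
      fix v w :: nat assume "v \<noteq> w"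
      then have "{(v, True)} \<noteq> {(w, True)}" by simp
      then have "C \<notin> X v \<or> C \<notin> X w" for C using X[of C v] X[of C w] by metis
      then show "X v \<inter> X w = {}" by blast
    qed
  qed simp
  moreover have "card (X v) = (n - 1) choose (k - 1)" if "v \<in> {1..n}" for v
    using card_graph_clauses[of k n "\<lambda>x. x = v" "\<lambda>A. v \<in> A"] card_subsets_containing[OF that assms]
    by (simp add: X_def)
  ultimately have "card {C \<in> k_clauses k n. npos C = 1} = n * ((n - 1) choose (k - 1))" by simp
  also have "\<dots> = k * (n choose k)"
    using binomial_absorption[of "k - 1" n] assms by simp
  finally show ?thesis .
qed

lemma card_npos_2: "card {C \<in> k_clauses 2 n. npos C = 2} = n choose 2"
proof -
  have "{C \<in> k_clauses 2 n. npos C = 2} = {C \<in> k_clauses 2 n. (\<forall>(v, b)\<in>C. b = True) \<and> True}"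
  proof (rule Collect_cong, rule conj_cong[OF refl])
    fix C assume C: "C \<in> k_clauses 2 n"
    have card: "card C = 2" "finite C" using k_clauses_finite[OF C] C by (simp_all add: k_clauses_def)
    have "npos C = 2 \<longleftrightarrow> (\<forall>l\<in>C. snd l)"
    proof
      assume "npos C = 2"
      then have "{l \<in> C. snd l} = C"
        using card by (intro card_subset_eq) (auto simp: npos_def)
      then show "\<forall>l\<in>C. snd l" by blast
    next
      assume "\<forall>l\<in>C. snd l"
      then have "{l \<in> C. snd l} = C" by blast
      then show "npos C = 2" using card by (simp add: npos_def)
    qed
    then show "npos C = 2 \<longleftrightarrow> (\<forall>(v, b)\<in>C. b = True) \<and> True"
      by (simp add: case_prod_beta)
  qed
  then show ?thesis using card_graph_clauses[of 2 n "\<lambda>_. True" "\<lambda>_. True"] by (simp add: n_subsets)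
qed

section \<open>The case of 2-SAT\<close>

text \<open>
  A literal and its negation have scores adding up to 5; variables divisible by 3 have the strongest
  preference for being true.
\<close>

definition score :: "literal \<Rightarrow> nat" where
  "score l = (if snd l then fst l mod 3 else 5 - fst l mod 3)"

lemma score_le: "score l \<le> 5" and score_neg: "score (neg l) = 5 - score l"
proof -
  have "fst l mod 3 < 3" by simp
  then have "fst l mod 3 \<le> 2" by linarith
  then show "score l \<le> 5" "score (neg l) = 5 - score l" by (simp_all add: score_def neg_def)
qed

lemma card_residue: "3 * card {v \<in> {1..n}. v mod 3 = r} \<le> n + 2"
proof -
  have "card {v \<in> {1..n}. v mod 3 = r} \<le> card {..<(n + 2) div 3}"
  proof (rule card_inj_on_le[where f = "\<lambda>v. (v - 1) div 3"])
    show "inj_on (\<lambda>v. (v - 1) div 3) {v \<in> {1..n}. v mod 3 = r}"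
    proof (rule inj_onI, clarify)
      fix v w assume *: "v \<in> {1..n}" "w \<in> {1..n}" "(v - 1) div 3 = (w - 1) div 3"
        and m: "w mod 3 = v mod 3"
      obtain v' w' where "v = Suc v'" "w = Suc w'" using * by (cases v; cases w) auto
      then have "v' div 3 = w' div 3" "Suc w' mod 3 = Suc v' mod 3" using * m by simp_all
      moreover from this(2) have "w' mod 3 = v' mod 3" by presburger
      ultimately have "v' = w'" by (metis div_mult_mod_eq)
      then show "v = w" using \<open>v = Suc v'\<close> \<open>w = Suc w'\<close> by simp
    qed
    show "(\<lambda>v. (v - 1) div 3) ` {v \<in> {1..n}. v mod 3 = r} \<subseteq> {..<(n + 2) div 3}"
      by auto
  qed simp
  then show ?thesis by simp
qed

text \<open>Scores 0, 1, 2 belong to positive literals and 3, 4, 5 to negative ones, with one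
  residue class modulo 3 for each score. A random literal thus has a nearly uniform score.\<close>

lemma card_score: "3 * card {l \<in> literals n. score l = s} \<le> n + 2"
proof (cases "s \<le> 2")
  case True
  have "{l \<in> literals n. score l = s} \<subseteq> (\<lambda>v. (v, True)) ` {v \<in> {1..n}. v mod 3 = s}"
  proof
    fix l assume l: "l \<in> {l \<in> literals n. score l = s}"
    have "fst l mod 3 < 3" by simp
    then have "snd l" using l True by (auto simp: score_def split: if_splits)
    with l show "l \<in> (\<lambda>v. (v, True)) ` {v \<in> {1..n}. v mod 3 = s}"
      by (cases l) (auto simp: literals_def score_def)
  qed
  then have "card {l \<in> literals n. score l = s} \<le> card {v \<in> {1..n}. v mod 3 = s}"
    by (rule surj_card_le[rotated]) simp
  with card_residue[of n s] show ?thesis by linarith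
next
  case False
  have "{l \<in> literals n. score l = s} \<subseteq> (\<lambda>v. (v, False)) ` {v \<in> {1..n}. v mod 3 = 5 - s}"
  proof
    fix l assume l: "l \<in> {l \<in> literals n. score l = s}"
    have "fst l mod 3 < 3" by simp
    then have "\<not> snd l" "fst l mod 3 = 5 - s" using l False by (auto simp: score_def split: if_splits)
    with l show "l \<in> (\<lambda>v. (v, False)) ` {v \<in> {1..n}. v mod 3 = 5 - s}"
      by (cases l) (auto simp: literals_def)
  qed
  then have "card {l \<in> literals n. score l = s} \<le> card {v \<in> {1..n}. v mod 3 = 5 - s}"
    by (rule surj_card_le[rotated]) simp
  with card_residue[of n "5 - s"] show ?thesis by linarith
qed

definition score_rank :: "clause \<Rightarrow> nat" where
  "score_rank C = sum score C"

lemma card_ordered_pairs: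
  assumes "X \<subseteq> k_clauses 2 n"
  shows "card {(a, b). {a, b} \<in> X} = 2 * card X"
proof -
  have two: "finite {(x, y). {x, y} = C} \<and> card {(x, y). {x, y} = C} = 2" if "C \<in> X" for C
  proof -
    have "C \<in> k_clauses 2 n" using that assms by blast
    then obtain a b where ab: "C = {a, b}" "fst a \<noteq> fst b" by (rule k_clauses_2E)
    then have "{(x, y). {x, y} = C} = {(a, b), (b, a)}"
      unfolding ab(1) doubleton_eq_iff by blast
    moreover have "a \<noteq> b" using ab by blast
    ultimately show ?thesis by simp
  qed
  have "{(a, b). {a, b} \<in> X} = (\<Union>C\<in>X. {(a, b). {a, b} = C})" by blast
  also have "card \<dots> = (\<Sum>C\<in>X. card {(a, b). {a, b} = C})"
  proof (rule card_UN_disjoint)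
    show "finite X" using assms finite_k_clauses finite_subset by blast
    show "\<forall>C\<in>X. \<forall>C'\<in>X. C \<noteq> C' \<longrightarrow> {(a, b). {a, b} = C} \<inter> {(a, b). {a, b} = C'} = {}" by blast
  qed (use two in blast)
  also have "\<dots> = (\<Sum>C\<in>X. 2)" using two by simp
  finally show ?thesis by simp
qed

text \<open>
  The ranks of a random 2-clause are distributed, up to a factor tending to 1, like the sum of two independent
  uniform scores; \<open>grid_tail r / 36\<close> is the probability that this sum is at least \<open>r\<close>.
\<close>

definition grid_tail :: "nat \<Rightarrow> real" where
  "grid_tail r = (\<Sum>s<6. \<Sum>t<6. if r \<le> s + t then 1 else 0)"

lemma card_score_rank_ge:
  "2 * real (card {C \<in> k_clauses 2 n. r \<le> score_rank C}) \<le> grid_tail r * ((real n + 2) / 3)\<^sup>2"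
proof -
  let ?L = "\<lambda>s. {l \<in> literals n. score l = s}"
  let ?I = "{(s, t). s < 6 \<and> t < 6 \<and> r \<le> s + t}"
  have I: "finite ?I" by (rule finite_subset[of _ "{..<6} \<times> {..<6}"]) auto
  have "{(a, b). {a, b} \<in> {C \<in> k_clauses 2 n. r \<le> score_rank C}} \<subseteq> (\<Union>(s, t)\<in>?I. ?L s \<times> ?L t)"
  proof clarify
    fix a b assume "{a, b} \<in> k_clauses 2 n" and r: "r \<le> score_rank {a, b}"
    then have ab: "a \<in> literals n" "b \<in> literals n" "a \<noteq> b" unfolding pair_in_k_clauses by auto
    with r have "r \<le> score a + score b" by (simp add: score_rank_def)
    moreover have "score a < 6" "score b < 6" using score_le[of a] score_le[of b] by auto
    ultimately show "(a, b) \<in> (\<Union>(s, t)\<in>?I. ?L s \<times> ?L t)"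
      using ab by (intro UN_I[of "(score a, score b)"]) auto
  qed
  then have "card {(a, b). {a, b} \<in> {C \<in> k_clauses 2 n. r \<le> score_rank C}} \<le> card (\<Union>(s, t)\<in>?I. ?L s \<times> ?L t)"
    using I by (intro card_mono) auto
  also have "\<dots> \<le> (\<Sum>(s, t)\<in>?I. card (?L s \<times> ?L t))"
    using card_UN_le[OF I, of "\<lambda>(s, t). ?L s \<times> ?L t"] by (simp add: case_prod_unfold)
  finally have "2 * card {C \<in> k_clauses 2 n. r \<le> score_rank C} \<le> (\<Sum>(s, t)\<in>?I. card (?L s) * card (?L t))"
    by (subst (asm) card_ordered_pairs[of _ n]) (auto simp: card_cartesian_product)
  then have "real (2 * card {C \<in> k_clauses 2 n. r \<le> score_rank C}) \<le>
      real (\<Sum>(s, t)\<in>?I. card (?L s) * card (?L t))"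
    by (rule of_nat_mono)
  also have "\<dots> = (\<Sum>(s, t)\<in>?I. real (card (?L s)) * real (card (?L t)))"
    by (simp add: case_prod_unfold)
  also have "\<dots> \<le> (\<Sum>(s, t)\<in>?I. ((real n + 2) / 3)\<^sup>2)"
  proof -
    have c: "real (card (?L s)) \<le> (real n + 2) / 3" for s
      using of_nat_mono[OF card_score[of n s], where 'a = real] by simp
    have "real (card (?L s)) * real (card (?L t)) \<le> ((real n + 2) / 3)\<^sup>2" for s t
      unfolding power2_eq_square using c by (intro mult_mono) auto
    then show ?thesis by (intro sum_mono) auto
  qed
  also have "\<dots> = (\<Sum>(s, t)\<in>?I. 1) * ((real n + 2) / 3)\<^sup>2"
    by (simp add: case_prod_unfold)
  also have "(\<Sum>(s, t)\<in>?I. 1) = grid_tail r"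
  proof -
    have "grid_tail r = (\<Sum>(s, t)\<in>{..<6} \<times> {..<6}. if r \<le> s + t then 1 else 0)"
      unfolding grid_tail_def by (rule sum.cartesian_product)
    also have "\<dots> = (\<Sum>(s, t)\<in>?I. 1)"
      by (rule sum.mono_neutral_cong_right) (auto split: if_splits)
    finally show ?thesis by simp
  qed
  finally show ?thesis by simp
qed

text \<open>The limiting ratio of the mass of a selected clause of rank r to its uniform mass: the
  quotient a^2 + a b + b^2 of \<open>pmf_selected\<close> for the tails
  \<open>grid_tail r / 36\<close> and \<open>grid_tail (Suc r) / 36\<close>.\<close>

definition density_factor :: "nat \<Rightarrow> real" where
  "density_factor r = ((grid_tail r)\<^sup>2 + grid_tail r * grid_tail (Suc r) + (grid_tail (Suc r))\<^sup>2) / 1296"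

lemma grid_tail_nonneg: "0 \<le> grid_tail r"
  by (auto simp: grid_tail_def intro!: sum_nonneg)

lemma density_factor_nonneg: "0 \<le> density_factor r"
  by (simp add: density_factor_def grid_tail_nonneg)

lemma pmf_selected_score_le:
  assumes "2 \<le> n" "C \<in> k_clauses 2 n"
  shows "pmf (selected score_rank 2 n) C \<le>
    ((real n + 2)\<^sup>2 / (real n * (real n - 1)))\<^sup>2 * density_factor (score_rank C) / (2 * (real n * (real n - 1)))"
proof -
  define N where "N = real (card (k_clauses 2 n))"
  define H where "H r = real (card {C \<in> k_clauses 2 n. r \<le> score_rank C}) / N" for r
  \<comment> \<open>The relative excess of the tail bound: rounded class sizes against the exact
    number of clauses. It is squared below because the point mass is quadratic in the tails.\<close>
  define \<delta> where "\<delta> = (real n + 2)\<^sup>2 / (real n * (real n - 1))"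
  let ?r = "score_rank C"
  have N: "N = 2 * (real n * (real n - 1))"
    unfolding N_def card_k_clauses using assms(1)
    by (simp add: choose_two real_of_nat_div of_nat_diff)
  have N0: "N > 0" unfolding N using assms by simp
  have H: "H r \<le> \<delta> * grid_tail r / 36" "0 \<le> H r" for r
  proof -
    have "real (card {C \<in> k_clauses 2 n. r \<le> score_rank C}) \<le> grid_tail r * (real n + 2)\<^sup>2 / 18"
      using card_score_rank_ge[of n r] by (simp add: power_divide)
    then have "H r \<le> grid_tail r * (real n + 2)\<^sup>2 / 18 / N"
      unfolding H_def using N0 by (intro divide_right_mono) auto
    then show "H r \<le> \<delta> * grid_tail r / 36" by (simp add: N \<delta>_def mult.commute)
    show "0 \<le> H r" using N0 by (simp add: H_def)
  qed
  have "pmf (selected score_rank 2 n) C = ((H ?r)\<^sup>2 + H ?r * H (Suc ?r) + (H (Suc ?r))\<^sup>2) / N"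
    using pmf_selected[of 2 n C score_rank] assms by (simp add: H_def N_def)
  also have "\<dots> \<le> ((\<delta> * grid_tail ?r / 36)\<^sup>2 + (\<delta> * grid_tail ?r / 36) * (\<delta> * grid_tail (Suc ?r) / 36)
      + (\<delta> * grid_tail (Suc ?r) / 36)\<^sup>2) / N"
    using N0 H order_trans[OF H(2) H(1)]
    by (intro divide_right_mono add_mono mult_mono power_mono) auto
  also have "\<dots> = \<delta>\<^sup>2 * density_factor ?r / N"
    by (simp add: density_factor_def power2_eq_square algebra_simps add_divide_distrib)
  finally show ?thesis unfolding N \<delta>_def .
qed

text \<open>
  An approximate Perron eigenvector of the limiting \<open>6 \<times> 6\<close> matrix of expected implications between
  the literals of score \<open>s\<close> and those of score \<open>t\<close>.
\<close>

definition score_weight :: "nat \<Rightarrow> real" where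
  "score_weight s = [39, 94, 202, 385, 654, 1000] ! s"

lemma score_weight_bounds: "s \<le> 5 \<Longrightarrow> 1 \<le> score_weight s \<and> score_weight s \<le> 1000"
  by (auto simp: score_weight_def less_Suc_eq numeral_eq_Suc le_Suc_eq)

lemma grid_tail_values:
  "map grid_tail [0, 1, 2, 3, 4, 5, 6, 7, 8, 9, 10, 11] = [36, 35, 33, 30, 26, 21, 15, 10, 6, 3, 1, 0]"
  by (simp add: grid_tail_def eval_nat_numeral)

lemma grid_tail_values_Suc:
  "grid_tail (Suc (Suc 0)) = 33" "grid_tail (Suc (Suc (Suc 0))) = 30" "grid_tail (Suc (Suc (Suc (Suc 0)))) = 26"
  using grid_tail_values by (simp_all add: eval_nat_numeral)

text \<open>The factor 19/60 is 19/10 times 1/6: about n / 3 literals per score, and 2 n^2 clauses.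
  An implication from score s to score t uses a clause of rank 5 - s + t, since negation reflects
  scores.\<close>

lemma score_weight_contraction:
  assumes "s \<le> 5"
  shows "19 / 60 * (\<Sum>t<6. density_factor (5 - s + t) * score_weight t) \<le> 995 / 1000 * score_weight s"
proof -
  have "s = 0 \<or> s = 1 \<or> s = 2 \<or> s = 3 \<or> s = 4 \<or> s = 5" using assms by arith
  moreover have "(\<Sum>t<6. f t) = f 0 + f 1 + f 2 + f 3 + f 4 + f 5" for f :: "nat \<Rightarrow> real"
    by (simp add: eval_nat_numeral)
  ultimately show ?thesis
    using grid_tail_values grid_tail_values_Suc by (auto simp: density_factor_def score_weight_def)
qed

lemma score_row_le:
  assumes "2 \<le> n" "a \<in> literals n"
  defines "\<delta> \<equiv> (real n + 2)\<^sup>2 / (real n * (real n - 1))"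
  shows "(\<Sum>b\<in>literals n. pmf (selected score_rank 2 n) {neg a, b} * score_weight (score b)) \<le>
    \<delta>\<^sup>2 * (real n + 2) / (6 * (real n * (real n - 1))) *
      (\<Sum>t<6. density_factor (5 - score a + t) * score_weight t)"
proof -
  define N where "N = 2 * (real n * (real n - 1))"
  have N0: "N > 0" using assms by (simp add: N_def)
  have w0: "0 \<le> score_weight (score b)" for b using score_weight_bounds[OF score_le[of b]] by linarith
  have "(\<Sum>b\<in>literals n. pmf (selected score_rank 2 n) {neg a, b} * score_weight (score b)) \<le>
      (\<Sum>b\<in>literals n. \<delta>\<^sup>2 * density_factor (5 - score a + score b) / N * score_weight (score b))"
  proof (intro sum_mono mult_right_mono w0)
    fix b assume b: "b \<in> literals n"
    show "pmf (selected score_rank 2 n) {neg a, b} \<le> \<delta>\<^sup>2 * density_factor (5 - score a + score b) / N"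
    proof (cases "{neg a, b} \<in> k_clauses 2 n")
      case True
      then have "neg a \<noteq> b" unfolding pair_in_k_clauses by auto
      then have "score_rank {neg a, b} = 5 - score a + score b"
        by (simp add: score_rank_def score_neg)
      then show ?thesis
        using pmf_selected_score_le[OF assms(1) True] by (simp add: \<delta>_def N_def)
    next
      case False
      then have "pmf (selected score_rank 2 n) {neg a, b} = 0"
        using set_selected[of 2 n score_rank] assms(1) by (auto simp: set_pmf_iff)
      then show ?thesis using N0 by (simp add: density_factor_nonneg)
    qed
  qed
  also have "\<dots> = (\<Sum>t<6. \<Sum>b\<in>{b \<in> literals n. score b = t}.
      \<delta>\<^sup>2 * density_factor (5 - score a + score b) / N * score_weight (score b))"
    using score_le by (intro sum.group[symmetric]) (auto simp: less_Suc_eq_le numeral_eq_Suc)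
  also have "\<dots> = (\<Sum>t<6. real (card {b \<in> literals n. score b = t}) *
      (\<delta>\<^sup>2 * density_factor (5 - score a + t) / N * score_weight t))"
    by simp
  also have "\<dots> \<le> (\<Sum>t<6. (real n + 2) / 3 * (\<delta>\<^sup>2 * density_factor (5 - score a + t) / N * score_weight t))"
  proof (intro sum_mono mult_right_mono)
    fix t :: nat assume t: "t \<in> {..<6}"
    show "real (card {b \<in> literals n. score b = t}) \<le> (real n + 2) / 3"
      using of_nat_mono[OF card_score[of n t], where 'a = real] by simp
    have "0 \<le> score_weight t" using score_weight_bounds[of t] t by auto
    then show "0 \<le> \<delta>\<^sup>2 * density_factor (5 - score a + t) / N * score_weight t"
      using N0 by (simp add: density_factor_nonneg)
  qed
  also have "\<dots> = \<delta>\<^sup>2 * (real n + 2) / (6 * (real n * (real n - 1))) *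
      (\<Sum>t<6. density_factor (5 - score a + t) * score_weight t)"
    unfolding sum_distrib_left by (intro sum.cong refl) (simp add: N_def)
  finally show ?thesis .
qed

theorem selected_2sat_satisfiable:
  "(\<lambda>n. measure_pmf.prob (replicate_pmf (nat \<lfloor>19 / 10 * real n\<rfloor>) (selected score_rank 2 n)) {F. satisfiable F}) \<longlonglongrightarrow> 1"
proof (rule subcritical_2cnf_satisfiable[where w = "\<lambda>_ b. score_weight (score b)" and R = 1000 and \<rho> = "998 / 1000" and K = 6])
  define m where "m n = nat \<lfloor>19 / 10 * real n\<rfloor>" for n
  have m: "real (m n) \<le> 19 / 10 * real n" for n unfolding m_def by (simp, linarith)
  show "\<forall>\<^sub>F n in sequentially. set_pmf (selected score_rank 2 n) \<subseteq> k_clauses 2 n"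
    using eventually_ge_at_top[of 2] by eventually_elim (rule set_selected)
  show "\<forall>\<^sub>F n in sequentially. \<forall>C. real (nat \<lfloor>19 / 10 * real n\<rfloor>) * pmf (selected score_rank 2 n) C \<le> 6 / real n"
    using eventually_ge_at_top[of 2]
  proof eventually_elim
    case (elim n)
    show ?case
    proof
      fix C
      \<comment> \<open>A crude bound from tails at most 1; selection from three clauses can at most
        triple a probability. At density 19/10 it gives 2.85 / (n - 1), below 6 / n.\<close>
      have "pmf (selected score_rank 2 n) C \<le> 3 / (2 * (real n * (real n - 1)))"
      proof (cases "C \<in> k_clauses 2 n")
        case True
        define H where "H r = real (card {C \<in> k_clauses 2 n. r \<le> score_rank C}) / card (k_clauses 2 n)" for r
        have H: "0 \<le> H r" "H r \<le> 1" for r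
          using card_mono[OF finite_k_clauses[of 2 n], of "{C \<in> k_clauses 2 n. r \<le> score_rank C}"]
          by (auto simp: H_def divide_le_eq)
        have "pmf (selected score_rank 2 n) C =
            ((H (score_rank C))\<^sup>2 + H (score_rank C) * H (Suc (score_rank C)) + (H (Suc (score_rank C)))\<^sup>2) / card (k_clauses 2 n)"
          using pmf_selected[of 2 n C score_rank] elim True by (simp add: H_def)
        also have "\<dots> \<le> (1 + 1 + 1) / card (k_clauses 2 n)"
          using H by (intro divide_right_mono add_mono) (auto simp: power_le_one mult_le_one)
        also have "real (card (k_clauses 2 n)) = 2 * (real n * (real n - 1))"
          unfolding card_k_clauses using elim
          by (simp add: choose_two real_of_nat_div of_nat_diff)
        finally show ?thesis by simp
      next
        case False
        then have "pmf (selected score_rank 2 n) C = 0"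
          using set_selected[of 2 n score_rank] elim by (auto simp: set_pmf_iff)
        then show ?thesis using elim by simp
      qed
      then have "real (m n) * pmf (selected score_rank 2 n) C \<le>
          (19 / 10 * real n) * (3 / (2 * (real n * (real n - 1))))"
        using m[of n] by (intro mult_mono) auto
      also have "\<dots> \<le> 6 / real n" using elim by (simp add: field_simps)
      finally show "real (nat \<lfloor>19 / 10 * real n\<rfloor>) * pmf (selected score_rank 2 n) C \<le> 6 / real n"
        by (simp add: m_def)
    qed
  qed
  \<comment> \<open>The gap between the limiting contraction 0.995 and the claimed 0.998 absorbs all
    finite-size factors.\<close>
  have "(\<lambda>n. ((real n + 2)\<^sup>2 / (real n * (real n - 1)))\<^sup>2 * ((real n + 2) / (real n - 1))) \<longlonglongrightarrow> 1"
    by real_asymp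
  then have "\<forall>\<^sub>F n in sequentially. ((real n + 2)\<^sup>2 / (real n * (real n - 1)))\<^sup>2 * ((real n + 2) / (real n - 1)) < 998 / 995"
    by (rule order_tendstoD) simp
  with eventually_ge_at_top[of 2]
  show "\<forall>\<^sub>F n in sequentially. \<forall>a\<in>literals n. real (nat \<lfloor>19 / 10 * real n\<rfloor>) *
      (\<Sum>b\<in>literals n. pmf (selected score_rank 2 n) {neg a, b} * score_weight (score b))
      \<le> 998 / 1000 * score_weight (score a)"
  proof eventually_elim
    case (elim n)
    show ?case
    proof
      fix a assume a: "a \<in> literals n"
      define \<delta> where "\<delta> = (real n + 2)\<^sup>2 / (real n * (real n - 1))"
      define S where "S = (\<Sum>t<6. density_factor (5 - score a + t) * score_weight t)"
      have w: "0 \<le> score_weight (score a)" using score_weight_bounds[OF score_le[of a]] by linarith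
      have S: "19 / 60 * S \<le> 995 / 1000 * score_weight (score a)"
        unfolding S_def by (rule score_weight_contraction[OF score_le])
      have "0 \<le> score_weight t" if "t \<in> {..<6}" for t
        using score_weight_bounds[of t] that by auto
      then have S0: "0 \<le> S"
        unfolding S_def by (intro sum_nonneg mult_nonneg_nonneg density_factor_nonneg) auto
      have "real (m n) * (\<Sum>b\<in>literals n. pmf (selected score_rank 2 n) {neg a, b} * score_weight (score b))
          \<le> (19 / 10 * real n) * (\<delta>\<^sup>2 * (real n + 2) / (6 * (real n * (real n - 1))) * S)"
        unfolding \<delta>_def S_def
        using m[of n] score_row_le[OF elim(1) a] score_weight_bounds[OF score_le]
        by (intro mult_mono sum_nonneg mult_nonneg_nonneg) (auto intro: order_trans[OF zero_le_one])
      also have "\<dots> = \<delta>\<^sup>2 * ((real n + 2) / (real n - 1)) * (19 / 60 * S)"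
        using elim by (simp add: field_simps)
      also have "\<dots> \<le> 998 / 995 * (995 / 1000 * score_weight (score a))"
      proof (rule mult_mono)
        show "\<delta>\<^sup>2 * ((real n + 2) / (real n - 1)) \<le> 998 / 995"
          using elim(2) unfolding \<delta>_def by (rule less_imp_le)
        show "0 \<le> 19 / 60 * S" using S0 by simp
      qed (use S in auto)
      finally show "real (nat \<lfloor>19 / 10 * real n\<rfloor>) *
          (\<Sum>b\<in>literals n. pmf (selected score_rank 2 n) {neg a, b} * score_weight (score b))
          \<le> 998 / 1000 * score_weight (score a)"
        by (simp add: m_def)
    qed
  qed
qed (use score_weight_bounds[OF score_le] in auto)

section \<open>Clauses of arbitrary length\<close>

text \<open>Capped at two positive literals because only two literals are kept: further positive
  ones cannot improve the pair.\<close>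

definition sign_rank :: "clause \<Rightarrow> nat" where
  "sign_rank C = 2 - min 2 (npos C)"

definition best_pairs :: "clause \<Rightarrow> clause set" where
  "best_pairs C = {p. p \<subseteq> C \<and> card p = 2 \<and> npos p = min 2 (npos C)}"

text \<open>
  The pair is drawn at random to make its distribution invariant under renaming variables; the strategy
  itself does not use it.
\<close>

definition selected_pair :: "nat \<Rightarrow> nat \<Rightarrow> clause pmf" where
  "selected_pair k n = bind_pmf (selected sign_rank k n) (\<lambda>C. pmf_of_set (best_pairs C))"

lemma npos_le_card: "finite C \<Longrightarrow> npos C \<le> card C"
  unfolding npos_def by (rule card_mono) auto

lemma best_pairs:
  assumes "C \<in> k_clauses k n" "2 \<le> k"
  shows "finite (best_pairs C)" "best_pairs C \<noteq> {}"
proof -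
  have C: "finite C" "card C = k"
    using assms(1) k_clauses_finite[OF assms(1)] by (simp_all add: k_clauses_def)
  show "finite (best_pairs C)"
    using C(1) unfolding best_pairs_def by simp
  define P where "P = {l \<in> C. snd l}"
  have P: "finite P" "P \<subseteq> C" "card P = npos C" using C by (auto simp: P_def npos_def)
  obtain p1 where p1: "p1 \<subseteq> P" "card p1 = min 2 (npos C)" "finite p1"
    using obtain_subset_with_card_n[of "min 2 (npos C)" P] P(3) by auto
  have "2 - card p1 \<le> card (C - P)"
    using C P assms by (simp add: card_Diff_subset p1(2) min_def) arith
  then obtain p2 where p2: "p2 \<subseteq> C - P" "card p2 = 2 - card p1" "finite p2"
    using obtain_subset_with_card_n by metis
  have "{l \<in> p1 \<union> p2. snd l} = p1" using p1(1) p2(1) unfolding P_def by blast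
  then have "npos (p1 \<union> p2) = card p1" by (simp add: npos_def)
  moreover have "card (p1 \<union> p2) = 2"
    using p1 p2 by (subst card_Un_disjoint) auto
  ultimately have "p1 \<union> p2 \<in> best_pairs C"
    using p1 p2 P(2) by (auto simp: best_pairs_def)
  then show "best_pairs C \<noteq> {}" by auto
qed

lemma best_pairs_in_k_clauses:
  "C \<in> k_clauses k n \<Longrightarrow> p \<in> best_pairs C \<Longrightarrow> p \<in> k_clauses 2 n"
  by (auto simp: best_pairs_def k_clauses_def dest: inj_on_subset)

lemma sign_rank_best_pairs: "p \<in> best_pairs C \<Longrightarrow> sign_rank p = sign_rank C"
  by (simp add: best_pairs_def sign_rank_def)

lemma set_selected_pair:
  assumes "2 \<le> k" "k \<le> n"
  shows "set_pmf (selected_pair k n) \<subseteq> k_clauses 2 n"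
proof
  fix p assume "p \<in> set_pmf (selected_pair k n)"
  then obtain C where "C \<in> k_clauses k n" "p \<in> set_pmf (pmf_of_set (best_pairs C))"
    using set_selected[OF assms(2)] by (auto simp: selected_pair_def)
  then show "p \<in> k_clauses 2 n"
    using best_pairs[OF _ assms(1), of C n] best_pairs_in_k_clauses by (simp add: set_pmf_of_set)
qed

lemma prob_selected_pair_ge:
  assumes "2 \<le> k" "k \<le> n"
  shows "measure_pmf.prob (selected_pair k n) {p. r \<le> sign_rank p} =
    measure_pmf.prob (selected sign_rank k n) {C. r \<le> sign_rank C}"
proof -
  have "map_pmf sign_rank (selected_pair k n) =
      bind_pmf (selected sign_rank k n) (\<lambda>C. map_pmf sign_rank (pmf_of_set (best_pairs C)))"
    by (simp add: selected_pair_def map_bind_pmf)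
  also have "\<dots> = bind_pmf (selected sign_rank k n) (\<lambda>C. return_pmf (sign_rank C))"
  proof (rule bind_pmf_cong[OF refl])
    fix C assume "C \<in> set_pmf (selected sign_rank k n)"
    then have C: "C \<in> k_clauses k n" using set_selected[OF assms(2)] by blast
    have "map_pmf sign_rank (pmf_of_set (best_pairs C)) = map_pmf (\<lambda>_. sign_rank C) (pmf_of_set (best_pairs C))"
      using best_pairs[OF C assms(1)] sign_rank_best_pairs by (intro map_pmf_cong refl) (simp add: set_pmf_of_set)
    then show "map_pmf sign_rank (pmf_of_set (best_pairs C)) = return_pmf (sign_rank C)"
      by (simp add: map_pmf_const)
  qed
  also have "\<dots> = map_pmf sign_rank (selected sign_rank k n)" by (simp add: map_pmf_def)
  finally have "measure_pmf.prob (map_pmf sign_rank (selected_pair k n)) {r..} =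
      measure_pmf.prob (map_pmf sign_rank (selected sign_rank k n)) {r..}" by simp
  then show ?thesis by (simp add: vimage_def)
qed

section \<open>Invariance under renaming of variables\<close>

definition rename :: "(nat \<Rightarrow> nat) \<Rightarrow> clause \<Rightarrow> clause" where
  "rename \<pi> C = map_prod \<pi> id ` C"

lemma rename_npos:
  assumes "inj \<pi>"
  shows "npos (rename \<pi> C) = npos C"
proof -
  have inj: "inj (map_prod \<pi> (id :: bool \<Rightarrow> bool))" using assms by (intro prod.inj_map) auto
  have "{l \<in> rename \<pi> C. snd l} = map_prod \<pi> id ` {l \<in> C. snd l}"
    by (auto simp: rename_def)
  then show ?thesis unfolding npos_def using inj by (simp add: card_image inj_on_subset)
qed

lemma inj_rename:
  assumes "inj \<pi>"
  shows "inj (rename \<pi>)"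
proof -
  have "inj (map_prod \<pi> (id :: bool \<Rightarrow> bool))" using assms by (intro prod.inj_map) auto
  then show ?thesis unfolding rename_def using inj_image_eq_iff by (intro injI) blast
qed

lemma rename_k_clauses:
  assumes "bij \<pi>" "\<pi> ` {1..n} = {1..n}"
  shows "bij_betw (rename \<pi>) (k_clauses k n) (k_clauses k n)"
proof -
  have inj: "inj \<pi>" using assms(1) by (rule bij_is_inj)
  have inj': "inj (map_prod \<pi> (id :: bool \<Rightarrow> bool))" using inj by (intro prod.inj_map) auto
  have "rename \<pi> C \<in> k_clauses k n" if C: "C \<in> k_clauses k n" for C
  proof -
    have "map_prod \<pi> id ` C \<subseteq> {1..n} \<times> UNIV"
      using C assms(2) by (auto simp: k_clauses_def)
    moreover have "card (map_prod \<pi> id ` C) = k"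
      using C inj' by (simp add: card_image inj_on_subset k_clauses_def)
    moreover have "inj_on fst (map_prod \<pi> id ` C)"
    proof (rule inj_on_imageI)
      have "inj_on (\<pi> \<circ> fst) C"
        using C inj_on_subset[OF inj subset_UNIV] by (intro comp_inj_on) (auto simp: k_clauses_def)
      then show "inj_on (fst \<circ> map_prod \<pi> id) C" by (simp add: comp_def)
    qed
    ultimately show ?thesis by (simp add: k_clauses_def rename_def)
  qed
  then have "rename \<pi> ` k_clauses k n \<subseteq> k_clauses k n" by blast
  moreover have "inj_on (rename \<pi>) (k_clauses k n)" using inj_rename[OF inj] inj_on_subset by blast
  ultimately show ?thesis
    by (simp add: bij_betw_def endo_inj_surj finite_k_clauses)
qed

lemma best_pairs_rename:
  assumes "inj \<pi>"
  shows "best_pairs (rename \<pi> C) = rename \<pi> ` best_pairs C"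
proof -
  have inj': "inj (map_prod \<pi> (id :: bool \<Rightarrow> bool))" using assms by (intro prod.inj_map) auto
  have card: "card (rename \<pi> p) = card p" for p
    unfolding rename_def using inj' by (simp add: card_image inj_on_subset)
  have sub: "q \<subseteq> rename \<pi> C \<longleftrightarrow> (\<exists>p\<subseteq>C. q = rename \<pi> p)" for q
    unfolding rename_def by (rule subset_image_iff)
  show ?thesis
  proof (intro equalityI subsetI)
    fix q assume q: "q \<in> best_pairs (rename \<pi> C)"
    then obtain p where p: "p \<subseteq> C" "q = rename \<pi> p" using sub by (auto simp: best_pairs_def)
    with q have "p \<in> best_pairs C" by (simp add: best_pairs_def card rename_npos[OF assms])
    with p show "q \<in> rename \<pi> ` best_pairs C" by blast
  next
    fix q assume "q \<in> rename \<pi> ` best_pairs C"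
    then obtain p where p: "p \<in> best_pairs C" "q = rename \<pi> p" by blast
    then have "q \<subseteq> rename \<pi> C" using sub[of q] by (auto simp: best_pairs_def)
    with p show "q \<in> best_pairs (rename \<pi> C)" by (simp add: best_pairs_def card rename_npos[OF assms])
  qed
qed

lemma map_selected_pair:
  assumes "2 \<le> k" "k \<le> n" and \<pi>: "bij \<pi>" "\<pi> ` {1..n} = {1..n}"
  shows "map_pmf (rename \<pi>) (selected_pair k n) = selected_pair k n"
proof -
  have inj: "inj \<pi>" using \<pi>(1) by (rule bij_is_inj)
  have "map_pmf (rename \<pi>) (selected_pair k n) =
      bind_pmf (selected sign_rank k n) (\<lambda>C. map_pmf (rename \<pi>) (pmf_of_set (best_pairs C)))"
    by (simp add: selected_pair_def map_bind_pmf)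
  also have "\<dots> = bind_pmf (selected sign_rank k n) (\<lambda>C. pmf_of_set (best_pairs (rename \<pi> C)))"
  proof (rule bind_pmf_cong[OF refl])
    fix C assume "C \<in> set_pmf (selected sign_rank k n)"
    then have C: "C \<in> k_clauses k n" using set_selected[OF assms(2)] by blast
    show "map_pmf (rename \<pi>) (pmf_of_set (best_pairs C)) = pmf_of_set (best_pairs (rename \<pi> C))"
      unfolding best_pairs_rename[OF inj]
      using inj_on_subset[OF inj_rename[OF inj] subset_UNIV] best_pairs[OF C assms(1)]
      by (intro map_pmf_of_set_inj)
  qed
  also have "\<dots> = bind_pmf (map_pmf (rename \<pi>) (selected sign_rank k n)) (\<lambda>C. pmf_of_set (best_pairs C))"
    by (simp add: bind_map_pmf)
  also have "map_pmf (rename \<pi>) (selected sign_rank k n) = selected sign_rank k n"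
    using assms by (intro map_selected rename_k_clauses) (auto simp: sign_rank_def rename_npos[OF inj])
  finally show ?thesis by (simp add: selected_pair_def)
qed

lemma npos_pair:
  "a \<noteq> b \<Longrightarrow> npos {a, b} = of_bool (snd a) + of_bool (snd b)"
proof -
  assume "a \<noteq> b"
  moreover have "{l \<in> {a, b}. snd l} = (if snd a then {a} else {}) \<union> (if snd b then {b} else {})" by auto
  ultimately show ?thesis by (auto simp: npos_def)
qed

lemma npos_le_2: "p \<in> k_clauses 2 n \<Longrightarrow> npos p \<le> 2"
  using npos_le_card[of p] k_clauses_finite[of p 2 n] by (simp add: k_clauses_def)

text \<open>Permutations of the variables act transitively on the pairs with a given number of
  positive literals, and the law of the kept pair is invariant under them.\<close>

lemma pmf_selected_pair_eq:
  assumes "2 \<le> k" "k \<le> n" and p: "p \<in> k_clauses 2 n" "q \<in> k_clauses 2 n" "npos p = npos q"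
  shows "pmf (selected_pair k n) p = pmf (selected_pair k n) q"
proof -
  obtain a b where ab: "p = {a, b}" "a \<in> literals n" "b \<in> literals n" "fst a \<noteq> fst b"
    using p(1) by (rule k_clauses_2E)
  obtain c d where cd: "q = {c, d}" "c \<in> literals n" "d \<in> literals n" "fst c \<noteq> fst d"
    using p(2) by (rule k_clauses_2E)
  have ne: "a \<noteq> b" "c \<noteq> d" using ab cd by auto
  have "of_bool (snd a) + of_bool (snd b) = (of_bool (snd c) + of_bool (snd d) :: nat)"
    using p(3) unfolding ab(1) cd(1) npos_pair[OF ne(1)] npos_pair[OF ne(2)] .
  then have "snd a = snd c \<and> snd b = snd d \<or> snd a = snd d \<and> snd b = snd c"
    by (cases "snd a"; cases "snd b"; cases "snd c"; cases "snd d") auto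
  then have "\<exists>c' d'. q = {c', d'} \<and> c' \<in> literals n \<and> d' \<in> literals n \<and> fst c' \<noteq> fst d' \<and>
      snd a = snd c' \<and> snd b = snd d'"
  proof
    assume "snd a = snd c \<and> snd b = snd d"
    with cd show ?thesis by (intro exI[of _ c] exI[of _ d]) simp
  next
    assume "snd a = snd d \<and> snd b = snd c"
    with cd show ?thesis by (intro exI[of _ d] exI[of _ c]) (simp add: insert_commute)
  qed
  then obtain c' d' where cd': "q = {c', d'}" "c' \<in> literals n" "d' \<in> literals n" "fst c' \<noteq> fst d'"
    "snd a = snd c'" "snd b = snd d'"
    by (elim exE conjE)
  define \<tau> where "\<tau> = Transposition.transpose (fst a) (fst c')"
  \<comment> \<open>The second swap fixes \<open>fst c'\<close>, which differs from both swapped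
    values, so the image of \<open>fst a\<close> survives.\<close>
  define \<pi> where "\<pi> = Transposition.transpose (\<tau> (fst b)) (fst d') \<circ> \<tau>"
  have mem: "fst a \<in> {1..n}" "fst b \<in> {1..n}" "fst c' \<in> {1..n}" "fst d' \<in> {1..n}"
    using ab cd' by (auto simp: literals_def)
  have \<tau>: "bij \<tau>" "\<tau> ` {1..n} = {1..n}"
    unfolding \<tau>_def using mem by (auto simp: transpose_image_eq)
  then have "\<tau> (fst b) \<in> {1..n}" using mem by blast
  then have \<pi>: "bij \<pi>" "\<pi> ` {1..n} = {1..n}"
    unfolding \<pi>_def image_comp[symmetric] using \<tau> mem by (auto simp: bij_comp transpose_image_eq)
  have "\<tau> (fst b) \<noteq> fst c'"
    using bij_is_inj[OF \<tau>(1)] ab(4) by (metis \<tau>_def injD transpose_apply_first)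
  then have "\<pi> (fst a) = fst c'" using cd'(4) by (simp add: \<pi>_def \<tau>_def)
  moreover have "\<pi> (fst b) = fst d'" by (simp add: \<pi>_def)
  ultimately have "rename \<pi> p = q"
  proof -
    assume "\<pi> (fst a) = fst c'" "\<pi> (fst b) = fst d'"
    then have "map_prod \<pi> id a = c'" "map_prod \<pi> id b = d'" using cd'(5,6) by (simp_all add: prod_eq_iff)
    then show ?thesis unfolding ab(1) cd'(1) rename_def by simp
  qed
  then show ?thesis
    using pmf_map_inj'[OF inj_rename[OF bij_is_inj[OF \<pi>(1)]], of "selected_pair k n" p]
      map_selected_pair[OF assms(1,2) \<pi>] by simp
qed

lemma npos_sign_rank: "p \<in> k_clauses 2 n \<Longrightarrow> npos p = 2 - sign_rank p"
  using npos_le_2[of p n] by (simp add: sign_rank_def)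

lemma prob_selected_sign_rank:
  assumes "2 \<le> k" "k \<le> n"
  shows "measure_pmf.prob (selected sign_rank k n) {C. 0 \<le> sign_rank C} = 1"
    and "measure_pmf.prob (selected sign_rank k n) {C. 1 \<le> sign_rank C} = ((real k + 1) / 2 ^ k) ^ 3"
    and "measure_pmf.prob (selected sign_rank k n) {C. 2 \<le> sign_rank C} = 1 / 8 ^ k"
    and "measure_pmf.prob (selected sign_rank k n) {C. 3 \<le> sign_rank C} = 0"
proof -
  have nz: "n choose k \<noteq> 0" using assms by simp
  have c0: "card {C \<in> k_clauses k n. 2 \<le> sign_rank C} = n choose k"
  proof -
    have "2 \<le> sign_rank C \<longleftrightarrow> npos C = 0" for C by (auto simp: sign_rank_def)
    then show ?thesis by (simp add: card_npos_0)
  qed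
  have c1: "card {C \<in> k_clauses k n. 1 \<le> sign_rank C} = (k + 1) * (n choose k)"
  proof -
    have "{C \<in> k_clauses k n. 1 \<le> sign_rank C} =
        {C \<in> k_clauses k n. npos C = 1} \<union> {C \<in> k_clauses k n. npos C = 0}"
      by (auto simp: sign_rank_def)
    also have "card \<dots> = card {C \<in> k_clauses k n. npos C = 1} + card {C \<in> k_clauses k n. npos C = 0}"
      using finite_k_clauses[of k n] by (intro card_Un_disjoint) auto
    finally show ?thesis using assms card_npos_1[of k n] by (simp add: card_npos_0)
  qed
  show "measure_pmf.prob (selected sign_rank k n) {C. 1 \<le> sign_rank C} = ((real k + 1) / 2 ^ k) ^ 3"
  proof -
    have "real ((k + 1) * (n choose k)) / real (2 ^ k * (n choose k)) = (real k + 1) / 2 ^ k"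
      using nz by (simp add: field_simps)
    then show ?thesis unfolding prob_selected_ge[OF assms(2)] c1 card_k_clauses by (simp only:)
  qed
  have "(2 ^ k) ^ 3 = ((2 :: real) ^ 3) ^ k" by (simp only: power_mult[symmetric] mult.commute)
  then have "(2 ^ k) ^ 3 = (8 :: real) ^ k" by simp
  then show "measure_pmf.prob (selected sign_rank k n) {C. 2 \<le> sign_rank C} = 1 / 8 ^ k"
    unfolding prob_selected_ge[OF assms(2)] c0 card_k_clauses using nz by (simp add: power_divide)
  show "measure_pmf.prob (selected sign_rank k n) {C. 3 \<le> sign_rank C} = 0"
  proof -
    have "\<not> 3 \<le> sign_rank C" for C by (simp add: sign_rank_def)
    then show ?thesis by simp
  qed
qed simp

text \<open>Level mass divided by level size. The masses for two, one and no positive literals are 1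
  - h, h - 8^-k and 8^-k, where h is the probability that all three presented clauses have at most
  one positive literal; the sizes are n (n - 1) times 1/2, 1 and 1/2.\<close>

lemma pmf_selected_pair:
  assumes k: "2 \<le> k" "k \<le> n" and "a \<in> literals n" "b \<in> literals n" "fst a \<noteq> fst b"
  defines "h \<equiv> ((real k + 1) / 2 ^ k) ^ 3"
  shows "pmf (selected_pair k n) {a, b} =
    (if snd a \<and> snd b then 2 * (1 - h) else if snd a \<or> snd b then h - 1 / 8 ^ k else 2 / 8 ^ k)
      / (real n * (real n - 1))"
proof -
  have n: "2 \<le> n" using k by simp
  then have P0: "real n * (real n - 1) > 0" by simp
  have choose: "real (n choose 2) = real n * (real n - 1) / 2"
    using n by (simp add: choose_two real_of_nat_div of_nat_diff)
  have p: "{a, b} \<in> k_clauses 2 n" using assms unfolding pair_in_k_clauses by simp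
  let ?r = "sign_rank {a, b}"
  have "pmf (selected_pair k n) {a, b} * card {q \<in> k_clauses 2 n. sign_rank q = ?r} =
      measure_pmf.prob (selected_pair k n) {q. sign_rank q = ?r}"
  proof (rule pmf_constant_on_level[OF finite_k_clauses set_selected_pair[OF k] p])
    fix q assume q: "q \<in> k_clauses 2 n" "sign_rank q = ?r"
    then have "npos q = npos {a, b}" using npos_sign_rank[OF q(1)] npos_sign_rank[OF p] by simp
    then show "pmf (selected_pair k n) q = pmf (selected_pair k n) {a, b}"
      by (rule pmf_selected_pair_eq[OF k q(1) p])
  qed
  also have "{q \<in> k_clauses 2 n. sign_rank q = ?r} = {q \<in> k_clauses 2 n. npos q = npos {a, b}}"
  proof (rule Collect_cong, rule conj_cong[OF refl])
    fix q assume "q \<in> k_clauses 2 n"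
    from npos_sign_rank[OF this] npos_sign_rank[OF p] show "sign_rank q = ?r \<longleftrightarrow> npos q = npos {a, b}"
      by (metis sign_rank_def)
  qed
  also have "measure_pmf.prob (selected_pair k n) {q. sign_rank q = ?r} =
      measure_pmf.prob (selected sign_rank k n) {C. ?r \<le> sign_rank C} -
      measure_pmf.prob (selected sign_rank k n) {C. Suc ?r \<le> sign_rank C}"
    unfolding prob_level prob_selected_pair_ge[OF k] ..
  finally have eq: "pmf (selected_pair k n) {a, b} * real (card {q \<in> k_clauses 2 n. npos q = npos {a, b}}) =
      measure_pmf.prob (selected sign_rank k n) {C. ?r \<le> sign_rank C} -
      measure_pmf.prob (selected sign_rank k n) {C. Suc ?r \<le> sign_rank C}" .
  have ne: "a \<noteq> b" using assms by auto
  note prob = prob_selected_sign_rank[OF k]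
  have solve: "x = c * y / P" if "0 < P" "x * (P / c) = y" "c \<noteq> 0" for x y c P :: real
    using that by (simp add: field_simps)
  consider "snd a" "snd b" | "snd a \<noteq> snd b" | "\<not> snd a" "\<not> snd b" by auto
  then show ?thesis
  proof cases
    case 1
    then have "npos {a, b} = 2" "?r = 0" by (simp_all add: npos_pair[OF ne] sign_rank_def)
    then have "pmf (selected_pair k n) {a, b} * (real n * (real n - 1) / 2) = 1 - h"
      using eq prob(1,2) by (simp add: card_npos_2 choose h_def)
    from solve[OF P0 this] show ?thesis using 1 by simp
  next
    case 2
    then have "npos {a, b} = 1" "?r = 1" by (auto simp: npos_pair[OF ne] sign_rank_def)
    then have "pmf (selected_pair k n) {a, b} * (2 * real (n choose 2)) = h - 1 / 8 ^ k"
      using eq prob(2,3) card_npos_1[of 2 n] by (simp add: h_def numeral_2_eq_2[symmetric])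
    moreover have "2 * real (n choose 2) = real n * (real n - 1) / 1" using choose by simp
    ultimately have "pmf (selected_pair k n) {a, b} * (real n * (real n - 1) / 1) = h - 1 / 8 ^ k" by simp
    from solve[OF P0 this] show ?thesis using 2 by auto
  next
    case 3
    then have "npos {a, b} = 0" "?r = 2" by (simp_all add: npos_pair[OF ne] sign_rank_def)
    then have "pmf (selected_pair k n) {a, b} * (real n * (real n - 1) / 2) = 1 / 8 ^ k"
      using eq prob(3,4) by (simp add: card_npos_0 choose numeral_3_eq_3)
    from solve[OF P0 this] show ?thesis using 3 by simp
  qed
qed

text \<open>By symmetry all n - 1 other variables contribute equally, which leaves 1 / n without an
  error term. Here \<open>a\<close> is the literal in the clause, so the implications start at
  \<open>neg a\<close>.\<close>

lemma selected_pair_row: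
  assumes k: "2 \<le> k" "k \<le> n" and a: "a \<in> literals n"
  defines "h \<equiv> ((real k + 1) / 2 ^ k) ^ 3"
  shows "(\<Sum>b\<in>literals n. pmf (selected_pair k n) {a, b} * (if snd b then 1 else s)) =
    (if snd a then 2 * (1 - h) + (h - 1 / 8 ^ k) * s else (h - 1 / 8 ^ k) + 2 / 8 ^ k * s) / real n"
proof -
  let ?f = "\<lambda>b. pmf (selected_pair k n) {a, b} * (if snd b then 1 else s)"
  let ?V = "{1..n} - {fst a}"
  have n: "2 \<le> n" using k by simp
  have va: "fst a \<in> {1..n}" using a by (auto simp: literals_def)
  have zero: "pmf (selected_pair k n) {a, b} = 0" if "fst b = fst a" for b
  proof -
    have "{a, b} \<notin> k_clauses 2 n" unfolding pair_in_k_clauses using that by simp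
    then show ?thesis using set_selected_pair[OF k] by (auto simp: set_pmf_iff)
  qed
  have "(\<Sum>b\<in>literals n. ?f b) = (\<Sum>v\<in>{1..n}. \<Sum>c\<in>UNIV. ?f (v, c))"
    unfolding literals_def by (subst sum.cartesian_product) (simp add: case_prod_unfold)
  also have "\<dots> = (\<Sum>v\<in>{1..n}. ?f (v, True) + ?f (v, False))"
    by (simp add: UNIV_bool add.commute)
  also have "\<dots> = (\<Sum>v\<in>?V. ?f (v, True) + ?f (v, False))"
    using va by (subst sum.remove[of _ "fst a"]) (auto simp: zero)
  also have "\<dots> = (\<Sum>v\<in>?V. (if snd a then 2 * (1 - h) + (h - 1 / 8 ^ k) * s else (h - 1 / 8 ^ k) + 2 / 8 ^ k * s)
      / (real n * (real n - 1)))"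
  proof (rule sum.cong[OF refl])
    fix v assume "v \<in> ?V"
    then have v: "(v, c) \<in> literals n" "fst a \<noteq> fst (v, c)" for c by (auto simp: literals_def)
    show "?f (v, True) + ?f (v, False) =
      (if snd a then 2 * (1 - h) + (h - 1 / 8 ^ k) * s else (h - 1 / 8 ^ k) + 2 / 8 ^ k * s)
      / (real n * (real n - 1))"
      unfolding pmf_selected_pair[OF k a v, folded h_def] by (simp add: add_divide_distrib)
  qed
  also have "\<dots> = real (card ?V) * ((if snd a then 2 * (1 - h) + (h - 1 / 8 ^ k) * s else (h - 1 / 8 ^ k) + 2 / 8 ^ k * s)
      / (real n * (real n - 1)))"
    by simp
  also have "real (card ?V) = real n - 1"
    using va n by (simp add: of_nat_diff)
  finally show ?thesis using n by simp
qed

text \<open>A branching process with two types: weight 1 for positive literals and s for negative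
  ones. The two conditions \<open>row\<close> are the rows of a negative and of a positive literal,
  in this order. Satisfiability then passes from the kept pairs to the whole clauses.\<close>

theorem selected_ksat_satisfiable:
  fixes \<alpha> s \<rho> :: real
  assumes k: "2 \<le> k" and \<alpha>: "0 < \<alpha>" and "1 \<le> s"
  defines "h \<equiv> ((real k + 1) / 2 ^ k) ^ 3"
  assumes row: "\<alpha> * (2 * (1 - h) + (h - 1 / 8 ^ k) * s) \<le> \<rho> * s"
    "\<alpha> * ((h - 1 / 8 ^ k) + 2 / 8 ^ k * s) \<le> \<rho>"
    and \<rho>: "0 \<le> \<rho>" "\<rho> < 1"
  shows "(\<lambda>n. measure_pmf.prob (replicate_pmf (nat \<lfloor>\<alpha> * real n\<rfloor>) (selected sign_rank k n)) {F. satisfiable F}) \<longlonglongrightarrow> 1"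
proof -
  define m where "m n = nat \<lfloor>\<alpha> * real n\<rfloor>" for n
  have m: "real (m n) \<le> \<alpha> * real n" for n unfolding m_def using \<alpha> by simp
  have lim: "(\<lambda>n. measure_pmf.prob (replicate_pmf (m n) (selected_pair k n)) {F. satisfiable F}) \<longlonglongrightarrow> 1"
  proof (rule subcritical_2cnf_satisfiable[where w = "\<lambda>_ b. if snd b then 1 else s" and R = s and \<rho> = \<rho> and K = "4 * \<alpha>"])
    show "\<forall>\<^sub>F n in sequentially. set_pmf (selected_pair k n) \<subseteq> k_clauses 2 n"
      using eventually_ge_at_top[of k] by eventually_elim (rule set_selected_pair[OF k])
    show "\<forall>\<^sub>F n in sequentially. \<forall>C. real (m n) * pmf (selected_pair k n) C \<le> 4 * \<alpha> / real n"
      using eventually_ge_at_top[of k]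
    proof eventually_elim
      case (elim n)
      have n: "2 \<le> n" using k elim by simp
      show ?case
      proof
        fix C
        have "pmf (selected_pair k n) C \<le> 2 / (real n * (real n - 1))"
        proof (cases "C \<in> k_clauses 2 n")
          case True
          then obtain a b where ab: "C = {a, b}" "a \<in> literals n" "b \<in> literals n" "fst a \<noteq> fst b"
            by (rule k_clauses_2E)
          have "measure_pmf.prob (selected sign_rank k n) {C. 1 \<le> sign_rank C} \<le> 1" by simp
          then have h: "0 \<le> h" "h \<le> 1" unfolding prob_selected_sign_rank(2)[OF k elim] h_def by auto
          define e :: real where "e = 1 / 8 ^ k"
          have e: "0 \<le> e" "e \<le> 1" "2 / 8 ^ k = 2 * e" by (auto simp: e_def divide_le_eq)
          show ?thesis
            unfolding ab(1) pmf_selected_pair[OF k elim ab(2-4)] h_def[symmetric] e(3) e_def[symmetric]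
            using h n e(1,2) by (intro divide_right_mono) auto
        next
          case False
          then have "pmf (selected_pair k n) C = 0"
            using set_selected_pair[OF k elim] by (auto simp: set_pmf_iff)
          then show ?thesis using n by simp
        qed
        then have "real (m n) * pmf (selected_pair k n) C \<le> (\<alpha> * real n) * (2 / (real n * (real n - 1)))"
          using m[of n] by (intro mult_mono) auto
        also have "\<dots> \<le> 4 * \<alpha> / real n" using n \<alpha> by (simp add: field_simps)
        finally show "real (m n) * pmf (selected_pair k n) C \<le> 4 * \<alpha> / real n" .
      qed
    qed
    show "\<forall>\<^sub>F n in sequentially. \<forall>a\<in>literals n. real (m n) *
        (\<Sum>b\<in>literals n. pmf (selected_pair k n) {neg a, b} * (if snd b then 1 else s))
        \<le> \<rho> * (if snd a then 1 else s)"
      using eventually_ge_at_top[of k]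
    proof eventually_elim
      case (elim n)
      have n: "2 \<le> n" using k elim by simp
      show ?case
      proof
        fix a assume a: "a \<in> literals n"
        let ?S = "\<Sum>b\<in>literals n. pmf (selected_pair k n) {neg a, b} * (if snd b then 1 else s)"
        have "real (m n) * ?S \<le> \<alpha> * real n * ?S"
          using m[of n] \<open>1 \<le> s\<close> by (intro mult_right_mono sum_nonneg) auto
        also have "\<dots> = \<alpha> * (if \<not> snd a then 2 * (1 - h) + (h - 1 / 8 ^ k) * s
            else (h - 1 / 8 ^ k) + 2 / 8 ^ k * s)"
        proof -
          have "neg a \<in> literals n" "snd (neg a) = (\<not> snd a)" using a by (simp_all, simp add: neg_def)
          then show ?thesis
            using n unfolding selected_pair_row[OF k elim \<open>neg a \<in> literals n\<close>] h_def by simp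
        qed
        also have "\<dots> \<le> \<rho> * (if snd a then 1 else s)" using row by simp
        finally show "real (m n) * ?S \<le> \<rho> * (if snd a then 1 else s)" .
      qed
    qed
  qed (use \<rho> \<open>1 \<le> s\<close> in auto)
  have "\<forall>\<^sub>F n in sequentially. measure_pmf.prob (replicate_pmf (m n) (selected_pair k n)) {F. satisfiable F} \<le>
      measure_pmf.prob (replicate_pmf (m n) (selected sign_rank k n)) {F. satisfiable F}"
    using eventually_ge_at_top[of k]
  proof eventually_elim
    case (elim n)
    show ?case
      unfolding selected_pair_def
    proof (rule prob_satisfiable_shrink)
      fix C p assume "C \<in> set_pmf (selected sign_rank k n)" "p \<in> set_pmf (pmf_of_set (best_pairs C))"
      then have "C \<in> k_clauses k n" "p \<in> set_pmf (pmf_of_set (best_pairs C))"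
        using set_selected[OF elim] by auto
      then have "p \<in> best_pairs C" using best_pairs[OF _ k, of C n] by (simp add: set_pmf_of_set)
      then show "p \<subseteq> C" by (simp add: best_pairs_def)
    qed
  qed
  then show ?thesis
    using tendsto_sandwich[OF _ always_eventually lim tendsto_const] by (simp add: m_def)
qed

section \<open>Numerical conditions\<close>

text \<open>The exponents are k \<alpha> / (2^k - 1) for k = 2, \<alpha> = 19/10 and k = 3, \<alpha>
  = 19/4. The bounds turn 2 - exp(...) into at most 43/25 and 15/8, so the powers have to stay below
  25/43 and 8/15.\<close>

lemma exp_bounds:
  "7 / 25 \<le> exp (- (19 / 15) :: real)" "1 / 8 \<le> exp (- (57 / 28) :: real)"
proof -
  have pow: "exp (real a / real b) \<le> c" if "(272 / 100) ^ a \<le> c ^ b" "0 < b" "0 \<le> c" for a b and c :: real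
  proof -
    have "exp (real a / real b) ^ b = exp 1 ^ a"
      using that(2) by (simp flip: exp_of_nat_mult)
    also have "\<dots> \<le> (272 / 100) ^ a"
      using e_less_272 by (intro power_mono) auto
    also have "\<dots> \<le> c ^ b" by (rule that)
    finally show ?thesis using that(2,3) by (simp add: power_mono_iff)
  qed
  have "exp (19 / 15) \<le> (25 / 7 :: real)" using pow[of 19 "25 / 7" 15] by (simp add: power_divide)
  then show "7 / 25 \<le> exp (- (19 / 15) :: real)" by (simp add: exp_minus field_simps)
  have "exp (57 / 28) \<le> (8 :: real)" using pow[of 57 8 28] by (simp add: power_divide)
  then show "1 / 8 \<le> exp (- (57 / 28) :: real)" by (simp add: exp_minus field_simps)
qed

lemma powr_rational_less:
  fixes b c :: real
  assumes "0 < b" "0 < c" "0 < q" "b ^ p < c ^ q"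
  shows "b powr (real p / real q) < c"
proof -
  have "(b powr (real p / real q)) ^ q = b ^ p"
    using assms by (simp add: powr_realpow[symmetric] powr_powr)
  with assms show ?thesis by (metis less_imp_le power_less_imp_less_base)
qed

lemma unsat_condition_2: "(1 - 1 / 2 ^ 2) powr (19 / 10) * (2 - exp (- (real 2 / (2 ^ 2 - 1) * (19 / 10)))) < 1"
proof -
  have "(3 / 4) powr (real 19 / real 10) < (25 / 43 :: real)"
    by (rule powr_rational_less) (simp_all add: power_divide)
  then have less: "(3 / 4) powr (19 / 10) < (25 / 43 :: real)" by simp
  have "(3 / 4) powr (19 / 10) * (2 - exp (- (19 / 15))) < (25 / 43 :: real) * (43 / 25)"
  proof (rule mult_less_le_imp_less[OF less])
    have "exp (- (19 / 15)) \<le> (1 :: real)" by simp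
    then show "0 < 2 - exp (- (19 / 15) :: real)" by linarith
  qed (use exp_bounds(1) in auto)
  then show ?thesis by (simp add: mult.commute)
qed

lemma unsat_condition_3: "(1 - 1 / 2 ^ 3) powr (19 / 4) * (2 - exp (- (real 3 / (2 ^ 3 - 1) * (19 / 4)))) < 1"
proof -
  have "(7 / 8) powr (real 19 / real 4) < (8 / 15 :: real)"
    by (rule powr_rational_less) (simp_all add: power_divide)
  then have less: "(7 / 8) powr (19 / 4) < (8 / 15 :: real)" by simp
  have "(7 / 8) powr (19 / 4) * (2 - exp (- (57 / 28))) < (8 / 15 :: real) * (15 / 8)"
  proof (rule mult_less_le_imp_less[OF less])
    have "exp (- (57 / 28)) \<le> (1 :: real)" by simp
    then show "0 < 2 - exp (- (57 / 28) :: real)" by linarith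
  qed (use exp_bounds(2) in auto)
  then show ?thesis by (simp add: mult.commute)
qed

lemma unsat_condition_ge_4:
  assumes "0 < k"
  defines "\<alpha> \<equiv> 7 / 10 * (2 :: real) ^ k"
  shows "(1 - 1 / 2 ^ k) powr \<alpha> * (2 - exp (- (real k / (2 ^ k - 1) * \<alpha>))) < 1"
proof -
  have k2: "(2::real) ^ k \<ge> 2" using power_increasing[of 1 k "2::real"] assms by simp
  have "(1 - 1 / 2 ^ k) powr \<alpha> \<le> exp (- (1 / 2 ^ k)) powr \<alpha>"
    using k2 exp_ge_add_one_self[of "- (1 / 2 ^ k)"] by (intro powr_mono2) (auto simp: \<alpha>_def)
  also have "\<dots> = exp (- (7 / 10))" by (simp add: powr_def \<alpha>_def)
  also have "\<dots> < 1 / 2"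
  proof -
    have "ln 2 < (7 / 10 :: real)" using ln2_le_25_over_36 by simp
    then have "2 < exp (7 / 10 :: real)" using exp_less_mono[of "ln 2" "7 / 10 :: real"] by simp
    then show ?thesis by (simp add: exp_minus field_simps)
  qed
  finally have *: "(1 - 1 / 2 ^ k) powr \<alpha> < 1 / 2" .
  \<comment> \<open>The gain from maximality is dropped here: the factor 2 counts all
    assignments.\<close>
  have "(1 - 1 / 2 ^ k) powr \<alpha> * (2 - exp (- (real k / (2 ^ k - 1) * \<alpha>))) \<le> (1 - 1 / 2 ^ k) powr \<alpha> * 2"
    by (intro mult_left_mono) auto
  with * show ?thesis by linarith
qed

text \<open>A negative literal has about 2 \<alpha> positive children, so its weight s has to be of
  order 2^k. With the factor 5/2, the negative row relative to s is at most 0.56 plus 7/10 of 2^k h,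
  and the positive row is at most 7/10 * (2^k h + 5 / 2^k).\<close>

lemma sat_condition_ge_4:
  assumes "4 \<le> k"
  defines "\<alpha> \<equiv> 7 / 10 * (2 :: real) ^ k" and "s \<equiv> 5 / 2 * (2 :: real) ^ k" and "h \<equiv> ((real k + 1) / 2 ^ k) ^ 3"
  shows "\<alpha> * (2 * (1 - h) + (h - 1 / 8 ^ k) * s) \<le> 95 / 100 * s"
    and "\<alpha> * ((h - 1 / 8 ^ k) + 2 / 8 ^ k * s) \<le> 95 / 100"
proof -
  \<comment> \<open>The value at k = 4 is the maximum: one step multiplies (k + 1)^3 by at most
    27/8, less than the 4 gained in the denominator.\<close>
  have h: "2 ^ k * h \<le> 125 / 256"
    unfolding h_def using assms(1)
  proof (induction k rule: dec_induct)
    case base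
    show ?case by (simp add: power3_eq_cube)
  next
    case (step k)
    have "(real (Suc k) + 1) ^ 3 \<le> 4 * (real k + 1) ^ 3"
    proof -
      have "(real (Suc k) + 1) ^ 3 \<le> (3 / 2 * (real k + 1)) ^ 3"
        using step by (intro power_mono) auto
      also have "\<dots> = 27 / 8 * (real k + 1) ^ 3" unfolding power_mult_distrib by (simp add: power_divide)
      also have "\<dots> \<le> 4 * (real k + 1) ^ 3" by (intro mult_right_mono) auto
      finally show ?thesis .
    qed
    then have "2 ^ k * ((real (Suc k) + 1) ^ 3 / 4) / (2 ^ k) ^ 3 \<le> 2 ^ k * (real k + 1) ^ 3 / (2 ^ k) ^ 3"
      by (intro divide_right_mono mult_left_mono) auto
    moreover have "2 ^ Suc k * ((real (Suc k) + 1) / 2 ^ Suc k) ^ 3 =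
        2 ^ k * ((real (Suc k) + 1) ^ 3 / 4) / (2 ^ k) ^ 3"
      by (simp add: power_divide power_mult_distrib)
    ultimately have "2 ^ Suc k * ((real (Suc k) + 1) / 2 ^ Suc k) ^ 3 \<le> 2 ^ k * ((real k + 1) / 2 ^ k) ^ 3"
      by (simp add: power_divide)
    with step show ?case by linarith
  qed
  have h0: "0 \<le> h" by (simp add: h_def)
  have k16: "(16::real) \<le> 2 ^ k" using power_increasing[of 4 k "2::real"] assms(1) by simp
  have "\<alpha> * (2 * (1 - h) + (h - 1 / 8 ^ k) * s) \<le> \<alpha> * (2 + h * s)"
    using h0 k16 by (intro mult_left_mono add_mono mult_right_mono) (auto simp: \<alpha>_def s_def)
  also have "\<dots> = 7 / 10 * (2 / (5 / 2) + 2 ^ k * h) * s"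
    by (simp add: \<alpha>_def s_def algebra_simps)
  also have "\<dots> \<le> 95 / 100 * s"
    using h k16 by (intro mult_right_mono) (auto simp: s_def mult.commute)
  finally show "\<alpha> * (2 * (1 - h) + (h - 1 / 8 ^ k) * s) \<le> 95 / 100 * s" .
  have eight: "(8::real) ^ k = 2 ^ k * 2 ^ k * 2 ^ k" by (simp flip: power_mult_distrib)
  have "\<alpha> * ((h - 1 / 8 ^ k) + 2 / 8 ^ k * s) \<le> \<alpha> * (h + 2 / 8 ^ k * s)"
    using k16 by (intro mult_left_mono) (auto simp: \<alpha>_def)
  also have "\<dots> = 7 / 10 * (2 ^ k * h + 5 / 2 ^ k)"
    unfolding \<alpha>_def s_def eight using k16 by (simp add: field_simps)
  also have "\<dots> \<le> 7 / 10 * (125 / 256 + 5 / 16)"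
    using h k16 by (intro mult_left_mono add_mono divide_left_mono) auto
  also have "\<dots> \<le> 95 / 100" by simp
  finally show "\<alpha> * ((h - 1 / 8 ^ k) + 2 / 8 ^ k * s) \<le> 95 / 100" .
qed

text \<open>The Perron ratio of the two weights is the square root of 448, about 21.17, and s is
  close to it. The density 19/4 lies between the first moment bound of about 4.67 and the critical
  value of about 4.86.\<close>

lemma sat_condition_3:
  defines "s \<equiv> 213 / 10 :: real" and "h \<equiv> ((real 3 + 1) / 2 ^ 3) ^ 3"
  shows "19 / 4 * (2 * (1 - h) + (h - 1 / 8 ^ 3) * s) \<le> 99 / 100 * s"
    and "19 / 4 * ((h - 1 / 8 ^ 3) + 2 / 8 ^ 3 * s) \<le> 99 / 100"
  by (simp_all add: s_def h_def power3_eq_cube)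

theorem theorem1:
  fixes k :: nat
  assumes "k \<ge> 2"
  shows "\<exists>\<alpha>::real. \<alpha> > 0 \<and>
    (\<exists>S :: nat \<Rightarrow> strategy.
      (\<forall>n. online_strategy 3 (S n)) \<and>
      (\<lambda>n. measure_pmf.prob (random_formula k n (nat \<lfloor>\<alpha> * real n\<rfloor>))
              {F. \<not> satisfiable F}) \<longlonglongrightarrow> 1 \<and>
      (\<lambda>n. measure_pmf.prob (achlioptas_formula 3 k n (S n) (nat \<lfloor>\<alpha> * real n\<rfloor>))
              {F. satisfiable F}) \<longlonglongrightarrow> 1)"
proof -
  \<comment> \<open>A single rank function serves all n, so the strategy obtained from it ignores
    both n and the history.\<close>
  have "\<exists>(\<alpha>::real) \<rho>. \<alpha> > 0 \<and>
      (\<lambda>n. measure_pmf.prob (random_formula k n (nat \<lfloor>\<alpha> * real n\<rfloor>)) {F. \<not> satisfiable F}) \<longlonglongrightarrow> 1 \<and>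
      (\<lambda>n. measure_pmf.prob (replicate_pmf (nat \<lfloor>\<alpha> * real n\<rfloor>) (selected \<rho> k n)) {F. satisfiable F}) \<longlonglongrightarrow> 1"
  proof -
    consider "k = 2" | "k = 3" | "4 \<le> k" using assms by linarith
    then show ?thesis
    proof cases
      case 1
      show ?thesis
        using selected_2sat_satisfiable random_formula_unsatisfiable[OF _ _ unsat_condition_2]
        by (intro exI[of _ "19 / 10"] exI[of _ score_rank]) (simp add: 1)
    next
      case 2
      have "(\<lambda>n. measure_pmf.prob (replicate_pmf (nat \<lfloor>19 / 4 * real n\<rfloor>) (selected sign_rank 3 n))
          {F. satisfiable F}) \<longlonglongrightarrow> 1"
        by (rule selected_ksat_satisfiable[OF _ _ _ sat_condition_3]) simp_all
      then show ?thesis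
        using random_formula_unsatisfiable[OF _ _ unsat_condition_3]
        by (intro exI[of _ "19 / 4"] exI[of _ sign_rank]) (simp add: 2)
    next
      case 3
      have "(1::real) \<le> 2 ^ k" by simp
      then have s: "1 \<le> 5 / 2 * (2::real) ^ k" by linarith
      have "(\<lambda>n. measure_pmf.prob (replicate_pmf (nat \<lfloor>7 / 10 * 2 ^ k * real n\<rfloor>) (selected sign_rank k n))
          {F. satisfiable F}) \<longlonglongrightarrow> 1"
        by (rule selected_ksat_satisfiable[OF assms _ s sat_condition_ge_4[OF 3]]) simp_all
      then show ?thesis
        using random_formula_unsatisfiable[OF _ _ unsat_condition_ge_4[of k]] assms
        by (intro exI[of _ "7 / 10 * 2 ^ k"] exI[of _ sign_rank]) simp
    qed
  qed
  then obtain \<alpha> :: real and \<rho> where \<alpha>: "\<alpha> > 0"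
    "(\<lambda>n. measure_pmf.prob (random_formula k n (nat \<lfloor>\<alpha> * real n\<rfloor>)) {F. \<not> satisfiable F}) \<longlonglongrightarrow> 1"
    "(\<lambda>n. measure_pmf.prob (replicate_pmf (nat \<lfloor>\<alpha> * real n\<rfloor>) (selected \<rho> k n)) {F. satisfiable F}) \<longlonglongrightarrow> 1"
    by blast
  have "arg_min_list \<rho> cs \<in> set cs" if "length cs = 3" for cs
    using that by (intro arg_min_list_in) auto
  then have "online_strategy 3 (\<lambda>h. arg_min_list \<rho>)"
    by (simp add: online_strategy_def)
  with \<alpha> show ?thesis
    by (intro exI[of _ \<alpha>] exI[of _ "\<lambda>n h. arg_min_list \<rho>"] conjI allI)
      (simp_all add: achlioptas_formula_memoryless selected_def)
qed

end
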